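(* Let $\Omega\subset\mathbb{C}^n$ be a domain and let $p\in\partial\Omega$ be a spherically-extreme boundary point of $\Omega$. Then $\displaystyle\lim_{\Omega\ni q\to p}\sigma_\Omega(q)=1$.
   Context: For $q\in\mathbb{C}^n$ and $r>0$ let $\mathbb{B}^n(q;r)=\{z\in\mathbb{C}^n:\|z-q\|<r\}$ (Euclidean norm) and $\mathbb{B}^n=\mathbb{B}^n(0;1)$. For a complex manifold $\Omega$ of dimension $n$ and $p\in\Omega$, let $\mathcal{F}(p,\Omega)$ be the set of injective holomorphic maps $f:\Omega\to\mathbb{B}^n$ with $f(p)=0$. The squeezing function is $\sigma_\Omega(p)=\sup\{r>0:\ \mathbb{B}^n(0;r)\subset f(\Omega)\text{ for some }f\in\mathcal{F}(p,\Omega)\}$. A boundary point $p\in\partial\Omega$ of a domain $\Omega\subset\mathbb{C}^n$ is called spherically-extreme if (1) $\partial\Omega$ is $\mathcal{C}^2$-smooth in an open neighborhood of $p$, and (2) there is a ball $\mathbb{B}^n(c;R)$ with $\Omega\subset\mathbb{B}^n(c;R)$ and $p\in\partial\Omega\cap\partial\mathbb{B}^n(c;R)$. *)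

theory Defs
  imports "HOL-Analysis.Analysis"
begin

definition holomorphic_map_on :: "(complex^'n \<Rightarrow> complex^'m) \<Rightarrow> (complex^'n) set \<Rightarrow> bool" where
  "holomorphic_map_on f S \<longleftrightarrow>
     (\<forall>z\<in>S. \<exists>L. (f has_derivative L) (at z) \<and> (\<forall>c v. L (c *s v) = c *s L v))"

definition squeezing_maps :: "(complex^'n) set \<Rightarrow> complex^'n \<Rightarrow> (complex^'n \<Rightarrow> complex^'n) set" where
  "squeezing_maps \<Omega> q = {f. holomorphic_map_on f \<Omega> \<and> inj_on f \<Omega> \<and> f ` \<Omega> \<subseteq> ball 0 1 \<and> f q = 0}"

definition squeezing_function :: "(complex^'n) set \<Rightarrow> complex^'n \<Rightarrow> real" where
  "squeezing_function \<Omega> q =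
     Sup {r. r > 0 \<and> (\<exists>f\<in>squeezing_maps \<Omega> q. ball 0 r \<subseteq> f ` \<Omega>)}"

definition C2_defining_function ::
  "'a::real_normed_vector set \<Rightarrow> ('a \<Rightarrow> real) \<Rightarrow> ('a \<Rightarrow> ('a \<Rightarrow>\<^sub>L real)) \<Rightarrow> bool" where
  "C2_defining_function U \<rho> D1 \<longleftrightarrow>
     (\<exists>D2 :: 'a \<Rightarrow> ('a \<Rightarrow>\<^sub>L ('a \<Rightarrow>\<^sub>L real)).
        (\<forall>x\<in>U. (\<rho> has_derivative blinfun_apply (D1 x)) (at x)) \<and>
        (\<forall>x\<in>U. (D1 has_derivative blinfun_apply (D2 x)) (at x)) \<and>
        continuous_on U D2)"

definition C2_boundary_near :: "'a::real_normed_vector set \<Rightarrow> 'a \<Rightarrow> bool" where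
  "C2_boundary_near \<Omega> p \<longleftrightarrow>
     (\<exists>U \<rho> D1. open U \<and> p \<in> U \<and> C2_defining_function U \<rho> D1 \<and>
        \<Omega> \<inter> U = {x\<in>U. \<rho> x < 0} \<and>
        (\<forall>x\<in>U \<inter> frontier \<Omega>. D1 x \<noteq> 0))"

definition spherically_extreme :: "(complex^'n) set \<Rightarrow> complex^'n \<Rightarrow> bool" where
  "spherically_extreme \<Omega> p \<longleftrightarrow>
     p \<in> frontier \<Omega> \<and> C2_boundary_near \<Omega> p \<and>
     (\<exists>c R. \<Omega> \<subseteq> ball c R \<and> p \<in> sphere c R)"

end

theory Submission
  imports Defs
begin

text \<open>
  Let \<open>\<nu>\<close> be the inner unit normal at \<open>p\<close>. The quadratic part of the defining function on the complex
  tangent space is \<open>lev z + Re (h z)\<close> with \<open>lev\<close> the Levi form and \<open>h\<close> a holomorphic quadratic form;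
  tangency to the sphere makes both \<open>lev z\<close> and \<open>lev z + Re (h z)\<close> at least \<open>c |z|\<^sup>2\<close>. For \<open>q\<close> near \<open>p\<close>
  follow \<open>- \<nu>\<close> from \<open>q\<close> to a boundary point \<open>x\<close>, take linear coordinates \<open>(s, z)\<close> at \<open>x\<close> in which \<open>Re s > 0\<close>
  supports the domain, and put \<open>w = s - h z * \<xi> s\<close>, where the cutoff \<open>\<xi>\<close> equals \<open>1\<close> at \<open>s = 0\<close> and
  varies so slowly that \<open>(s, z) \<mapsto> (w, z)\<close> stays injective on the whole domain. Near \<open>x\<close> the image is then
  \<open>lev z < Re w + o(|w|)\<close>, an almost exact Siegel half space, while far from \<open>x\<close> it keeps away from \<open>w = 0\<close>.
  The Cayley transform \<open>(w, z) \<mapsto> ((w - a) / (w + cnj a), 2 sqrt (Re a) z / (w + cnj a))\<close> with \<open>a = w(q)\<close>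
  maps \<open>q\<close> to the origin, and \<open>|(w - a)|\<^sup>2 + 4 Re a lev z = |w + cnj a|\<^sup>2 + 4 Re a (lev z - Re w)\<close> shows that
  as \<open>a\<close> tends to \<open>0\<close> the image lies between balls with radii tending to \<open>1\<close>: the far part of the domain
  is pushed to a single boundary point, so a crude bound suffices there.
\<close>

section \<open>Holomorphic functions and Hermitian forms on complex vectors\<close>

lemma norm_vector_scalar_mult:
  fixes v :: "complex^'n"
  shows "norm (c *s v) = norm c * norm v"
  by (simp add: norm_vec_def norm_mult L2_set_right_distrib)

lemma bounded_bilinear_vector_scalar_mult:
  "bounded_bilinear ((*s) :: complex \<Rightarrow> complex^'n \<Rightarrow> complex^'n)"
proof
  show "\<exists>K. \<forall>a b. norm (a *s b :: complex^'n) \<le> norm a * norm b * K"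
    by (rule exI[of _ 1]) (simp add: norm_vector_scalar_mult)
qed (simp_all add: vec_eq_iff algebra_simps)

definition clinear_form :: "(complex^'n \<Rightarrow> complex) \<Rightarrow> bool" where
  "clinear_form l \<longleftrightarrow> bounded_linear l \<and> (\<forall>c v. l (c *s v) = c * l v)"

text \<open>Scalar, pointwise counterpart of the condition in \<open>holomorphic_map_on\<close>.
  Keeping scalars apart gives products, quotients and compositions with functions of one complex
  variable.\<close>

definition holo_at :: "(complex^'n \<Rightarrow> complex) \<Rightarrow> complex^'n \<Rightarrow> bool" where
  "holo_at f z \<longleftrightarrow> (\<exists>D. (f has_derivative D) (at z) \<and> (\<forall>c v. D (c *s v) = c * D v))"

lemma holo_at_const: "holo_at (\<lambda>_. k) z"
  unfolding holo_at_def by (rule exI[of _ "\<lambda>_. 0"]) auto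

lemma holo_at_linear:
  assumes "clinear_form l"
  shows "holo_at (\<lambda>v. l (v - x)) z"
proof -
  have "((\<lambda>v. v - x) has_derivative (\<lambda>v. v)) (at z)"
    by (auto intro!: derivative_eq_intros)
  from bounded_linear.has_derivative[OF _ this, of l] show ?thesis
    using assms unfolding holo_at_def clinear_form_def by blast
qed

lemma holo_at_add: "holo_at f z \<Longrightarrow> holo_at g z \<Longrightarrow> holo_at (\<lambda>x. f x + g x) z"
  unfolding holo_at_def
  apply (elim exE conjE)
  subgoal for D E by (rule exI[of _ "\<lambda>v. D v + E v"])
      (auto intro!: derivative_eq_intros simp: algebra_simps)
  done

lemma holo_at_diff: "holo_at f z \<Longrightarrow> holo_at g z \<Longrightarrow> holo_at (\<lambda>x. f x - g x) z"
  unfolding holo_at_def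
  apply (elim exE conjE)
  subgoal for D E by (rule exI[of _ "\<lambda>v. D v - E v"])
      (auto intro!: derivative_eq_intros simp: algebra_simps)
  done

lemma holo_at_mult: "holo_at f z \<Longrightarrow> holo_at g z \<Longrightarrow> holo_at (\<lambda>x. f x * g x) z"
  unfolding holo_at_def
  apply (elim exE conjE)
  subgoal for D E by (rule exI[of _ "\<lambda>v. f z * E v + D v * g z"])
      (auto intro!: derivative_eq_intros simp: algebra_simps)
  done

lemma holo_at_compose:
  assumes "holo_at f z" "(g has_field_derivative d) (at (f z))"
  shows "holo_at (\<lambda>x. g (f x)) z"
proof -
  obtain D where D: "(f has_derivative D) (at z)" "\<And>c v. D (c *s v) = c * D v"
    using assms(1) by (auto simp: holo_at_def)
  have "((\<lambda>x. g (f x)) has_derivative (\<lambda>v. d * D v)) (at z)"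
    using has_derivative_compose[OF D(1) assms(2)[unfolded has_field_derivative_def]] by simp
  then show ?thesis using D(2) unfolding holo_at_def by (intro exI[of _ "\<lambda>v. d * D v"]) auto
qed

lemma holo_at_divide:
  assumes "holo_at f z" "holo_at g z" "g z \<noteq> 0"
  shows "holo_at (\<lambda>x. f x / g x) z"
proof -
  have "holo_at (\<lambda>x. inverse (g x)) z"
    by (rule holo_at_compose[OF assms(2)]) (auto intro!: derivative_eq_intros assms(3))
  from holo_at_mult[OF assms(1) this] show ?thesis by (simp only: divide_inverse)
qed

lemma holomorphic_map_scale:
  fixes g :: "complex^'n \<Rightarrow> complex^'m"
  assumes "\<And>z. z \<in> S \<Longrightarrow> holo_at f z" "holomorphic_map_on g S"
  shows "holomorphic_map_on (\<lambda>x. f x *s g x) S"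
  unfolding holomorphic_map_on_def
proof
  fix z assume z: "z \<in> S"
  obtain D where D: "(f has_derivative D) (at z)" "\<And>c v. D (c *s v) = c * D v"
    using assms(1)[OF z] by (auto simp: holo_at_def)
  obtain E where E: "(g has_derivative E) (at z)" "\<And>c v. E (c *s v) = c *s E v"
    using assms(2) z by (auto simp: holomorphic_map_on_def)
  show "\<exists>L. ((\<lambda>x. f x *s g x) has_derivative L) (at z) \<and> (\<forall>c v. L (c *s v) = c *s L v)"
    using bounded_bilinear.FDERIV[OF bounded_bilinear_vector_scalar_mult D(1) E(1)]
    by (rule exI[where x = "\<lambda>v. f z *s E v + D v *s g z", OF conjI])
      (simp add: D(2) E(2) vec_eq_iff algebra_simps)
qed

lemma holomorphic_map_add:
  assumes "holomorphic_map_on f S" "holomorphic_map_on g S"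
  shows "holomorphic_map_on (\<lambda>x. f x + g x) S"
  unfolding holomorphic_map_on_def
proof
  fix z assume z: "z \<in> S"
  obtain D where D: "(f has_derivative D) (at z)" "\<And>c v. D (c *s v) = c *s D v"
    using assms(1) z by (auto simp: holomorphic_map_on_def)
  obtain E where E: "(g has_derivative E) (at z)" "\<And>c v. E (c *s v) = c *s E v"
    using assms(2) z by (auto simp: holomorphic_map_on_def)
  show "\<exists>L. ((\<lambda>x. f x + g x) has_derivative L) (at z) \<and> (\<forall>c v. L (c *s v) = c *s L v)"
    by (rule exI[of _ "\<lambda>v. D v + E v"])
      (auto intro!: derivative_intros D E simp: D(2) E(2) vector_add_ldistrib)
qed

lemma holomorphic_map_linear:
  assumes "holomorphic_map_on f S" "bounded_linear M" "\<And>c v. M (c *s v) = c *s M v"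
  shows "holomorphic_map_on (\<lambda>x. M (f x)) S"
  unfolding holomorphic_map_on_def
proof
  fix z assume z: "z \<in> S"
  obtain D where D: "(f has_derivative D) (at z)" "\<And>c v. D (c *s v) = c *s D v"
    using assms(1) z by (auto simp: holomorphic_map_on_def)
  show "\<exists>L. ((\<lambda>x. M (f x)) has_derivative L) (at z) \<and> (\<forall>c v. L (c *s v) = c *s L v)"
    by (rule exI[of _ "\<lambda>v. M (D v)"])
      (auto intro!: bounded_linear.has_derivative[OF assms(2)] D simp: D(2) assms(3))
qed

lemma holomorphic_map_const: "holomorphic_map_on (\<lambda>_. k) S"
  unfolding holomorphic_map_on_def
  by (auto intro!: exI[of _ "\<lambda>_. 0"])

lemma holomorphic_map_translate: "holomorphic_map_on (\<lambda>v. v - k) S"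
  unfolding holomorphic_map_on_def
  by (auto intro!: exI[of _ "\<lambda>v. v"] derivative_eq_intros)

section \<open>Complex-linear extension of real forms and orthonormal bases of Hermitian
  forms\<close>

definition complexify :: "(complex^'n \<Rightarrow> real) \<Rightarrow> complex^'n \<Rightarrow> complex" where
  "complexify l u = Complex (l u) (- l (\<i> *s u))"

lemma vector_complex_decomp:
  fixes u :: "complex^'n"
  shows "c *s u = Re c *\<^sub>R u + Im c *\<^sub>R (\<i> *s u)"
  by (simp add: vec_eq_iff complex_eq_iff)

lemma scaleR_eq_complex_scale: "r *\<^sub>R v = complex_of_real r *s (v :: complex^'n)"
  by (simp add: vec_eq_iff complex_eq_iff)

lemma ii_scale_scale: "\<i> *s (\<i> *s u) = - (u :: complex^'n)"
  by (simp add: vec_eq_iff)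

text \<open>Replacing \<open>u\<close> by \<open>\<i> *s u\<close> turns the pair
  \<open>l u\<close>, \<open>- l (\<i> *s u)\<close> into \<open>l (\<i> *s u)\<close>,
  \<open>l u\<close>, which is multiplication by the imaginary unit. Hence
  \<open>complexify l\<close> is the complex-linear form with real part \<open>l\<close>.\<close>

lemma clinear_form_complexify:
  fixes l :: "complex^'n \<Rightarrow> real"
  assumes "linear l"
  shows "clinear_form (complexify l)"
proof -
  interpret linear l by fact
  have lc: "l (c *s u) = Re c * l u + Im c * l (\<i> *s u)" for c u
    unfolding vector_complex_decomp[of c u] by (simp only: add scale real_scaleR_def)
  have "l (\<i> *s (c *s u)) = Re c * l (\<i> *s u) - Im c * l u" for c u
    using lc[of "\<i> * c" u] by simp
  then have cl: "complexify l (c *s u) = c * complexify l u" for c u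
    using lc[of c u] by (simp add: complexify_def complex_eq_iff)
  have sc: "\<i> *s (r *\<^sub>R u) = r *\<^sub>R (\<i> *s u)" for r and u :: "complex^'n"
    by (simp add: vec_eq_iff)
  have "linear (complexify l)"
    by (rule linearI) (simp_all add: complexify_def complex_eq_iff vector_add_ldistrib add scale sc)
  with cl show ?thesis by (simp add: clinear_form_def linear_conv_bounded_linear)
qed

lemma complexify_add: "linear l \<Longrightarrow> complexify l (u + v) = complexify l u + complexify l v"
  and complexify_scale: "linear l \<Longrightarrow> complexify l (c *s u) = c * complexify l u"
  using clinear_form_complexify[of l]
  by (auto simp: clinear_form_def linear_conv_bounded_linear[symmetric] linear_add)

text \<open>\<open>M\<close> is the coordinate map of a basis that is orthonormal for the Hermitian form with real part \<open>G\<close>.\<close>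

lemma hermitian_form_isometry:
  fixes G :: "complex^'n \<Rightarrow> complex^'n \<Rightarrow> real"
  assumes bil: "bilinear G" and sym: "\<And>u v. G u v = G v u"
    and inv: "\<And>u v. G (\<i> *s u) (\<i> *s v) = G u v" and pos: "\<And>u. u \<noteq> 0 \<Longrightarrow> G u u > 0"
  obtains M :: "complex^'n \<Rightarrow> complex^'n" where
    "linear M" "\<And>c v. M (c *s v) = c *s M v" "bij M" "\<And>u. (norm (M u))\<^sup>2 = G u u"
proof -
  \<comment> \<open>\<open>g\<close> is the Hermitian form with real part \<open>G\<close>; it is
    conjugate-symmetric because \<open>G\<close> is symmetric and invariant under the imaginary
    unit.\<close>
  define g where "g u v = complexify (\<lambda>x. G x v) u" for u v
  have linl: "linear (\<lambda>x. G x v)" and linr: "linear (G v)" for v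
    using bil by (auto simp: bilinear_def)
  have gadd: "g (u + u') v = g u v + g u' v" and gsc: "g (c *s u) v = c * g u v" for u u' v c
    by (simp_all add: g_def complexify_add[OF linl] complexify_scale[OF linl])
  have gherm: "g v u = cnj (g u v)" for u v
  proof -
    have "G (\<i> *s v) u = G (\<i> *s (\<i> *s v)) (\<i> *s u)" by (simp only: inv)
    also have "\<dots> = - G v (\<i> *s u)" unfolding ii_scale_scale using linear_neg[OF linl] by blast
    finally show ?thesis by (simp add: g_def complexify_def complex_eq_iff sym)
  qed
  have gself: "g v v = of_real (G v v)" for v
  proof -
    have "Im (g v v) = 0" using arg_cong[OF gherm[of v v], of Im] by simp
    then show ?thesis by (simp add: complex_eq_iff) (simp add: g_def complexify_def)
  qed
  have gaddr: "g u (v + v') = g u v + g u v'" and gscr: "g u (c *s v) = cnj c * g u v" for u v v' c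
    unfolding gherm[of u "v + v'"] gherm[of u v] gherm[of u v'] gherm[of u "c *s v"]
    by (simp_all add: gadd gsc)
  have g0: "g 0 v = 0" "g v 0 = 0" for v
    using gsc[of 0 0 v] gscr[of v 0 0] by auto
  have gsuml: "g (\<Sum>i\<in>S. f i) v = (\<Sum>i\<in>S. g (f i) v)" if "finite S" for S :: "'n set" and f v
    using that by induction (auto simp: gadd g0)
  have gsumr: "g v (\<Sum>i\<in>S. f i) = (\<Sum>i\<in>S. g v (f i))" if "finite S" for S :: "'n set" and f v
    using that by induction (auto simp: gaddr g0)
  \<comment> \<open>Gram-Schmidt by induction on the index set: as long as an index \<open>k\<close>
    is missing, some nonzero vector is orthogonal to all vectors found so far.\<close>
  have "\<exists>e :: 'n \<Rightarrow> complex^'n. \<forall>i\<in>S. \<forall>j\<in>S. g (e i) (e j) = (if i = j then 1 else 0)" for S :: "'n set"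
  proof (induction S rule: finite_induct[OF finite])
    case 1 then show ?case by simp
  next
    case (2 k S)
    then obtain e :: "'n \<Rightarrow> complex^'n" where e: "\<And>i j. i \<in> S \<Longrightarrow> j \<in> S \<Longrightarrow> g (e i) (e j) = (if i = j then 1 else 0)"
      by blast
    \<comment> \<open>\<open>T\<close> records the products with the vectors found so far and leaves
      coordinate \<open>k\<close> zero. It is not onto, so in finite dimension it has a nonzero
      kernel vector.\<close>
    define T :: "complex^'n \<Rightarrow> complex^'n" where "T v = (\<chi> i. if i \<in> S then g v (e i) else 0)" for v
    have "linear T"
    proof (rule linearI)
      have "g (r *\<^sub>R v) w = r *\<^sub>R g v w" for r v w
        by (simp add: scaleR_eq_complex_scale gsc scaleR_conv_of_real)
      then show "T (r *\<^sub>R v) = r *\<^sub>R T v" for r v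
        by (simp add: T_def vec_eq_iff)
    qed (simp add: T_def vec_eq_iff gadd)
    moreover have "\<not> surj T"
    proof
      assume "surj T"
      then obtain v where "T v = axis k 1" by (metis surjD)
      then have "T v $ k = 1" by simp
      then show False using 2 by (simp add: T_def)
    qed
    ultimately have "\<not> inj T" using linear_injective_imp_surjective by blast
    then obtain u where u: "u \<noteq> 0" "T u = 0"
      using \<open>linear T\<close> linear_injective_0 by blast
    define u' where "u' = of_real (1 / sqrt (G u u)) *s u"
    have "g u' u' = of_real (1 / sqrt (G u u) * (1 / sqrt (G u u) * G u u))"
      unfolding u'_def gsc gscr gself[of u] complex_cnj_complex_of_real of_real_mult ..
    then have uu: "g u' u' = 1"
      using pos[OF u(1)] by simp
    have ui: "g u' (e i) = 0" "g (e i) u' = 0" if "i \<in> S" for i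
    proof -
      have "T u $ i = 0" using u by simp
      then have "g u (e i) = 0" using that by (simp add: T_def)
      then show "g u' (e i) = 0" by (simp add: u'_def gsc)
      then show "g (e i) u' = 0" unfolding gherm[of "e i" u'] by simp
    qed
    show ?case
      by (rule exI[of _ "e(k := u')"]) (use 2 e uu ui in auto)
  qed
  from this[of UNIV] obtain e :: "'n \<Rightarrow> complex^'n"
    where e: "\<And>i j. g (e i) (e j) = (if i = j then 1 else 0)" by auto
  \<comment> \<open>\<open>A\<close> turns coordinates into vectors and carries the Euclidean norm
    to \<open>G\<close>. It is therefore injective, hence bijective, and its inverse is the desired
    \<open>M\<close>.\<close>
  define A where "A c = (\<Sum>i\<in>UNIV. (c $ i) *s e i)" for c :: "complex^'n"
  have linA: "linear A"
    by (rule linearI) (simp_all add: A_def vec_eq_iff sum.distrib algebra_simps scaleR_sum_right)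
  have Ac: "A (k *s c) = k *s A c" for k c
    by (simp add: A_def vec_eq_iff sum_distrib_left algebra_simps)
  have "complex_of_real (G (A c) (A c)) = complex_of_real ((norm c)\<^sup>2)" for c
  proof -
    have "g (A c) (A c) = (\<Sum>i\<in>UNIV. c $ i * cnj (c $ i))"
      by (simp add: A_def gsuml gsumr gsc gscr e if_distrib mult.commute cong: if_cong)
    also have "\<dots> = of_real (\<Sum>i\<in>UNIV. (norm (c $ i))\<^sup>2)"
      by (simp only: complex_norm_square[symmetric] of_real_sum)
    also have "(\<Sum>i\<in>UNIV. (norm (c $ i))\<^sup>2) = (norm c)\<^sup>2"
      by (simp add: norm_vec_def L2_set_def sum_nonneg)
    finally show ?thesis by (simp add: gself)
  qed
  then have nA: "G (A c) (A c) = (norm c)\<^sup>2" for c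
    using of_real_eq_iff by blast
  have injA: "inj A"
  proof (subst linear_injective_0[OF linA], intro allI impI)
    fix c assume "A c = 0"
    then have "G (A c) (A c) = 0" using linear_0[OF linr] by simp
    then show "c = 0" by (simp add: nA)
  qed
  have surjA: "surj A" using linA injA linear_injective_imp_surjective by blast
  define M where "M = inv A"
  have AM: "A (M v) = v" and MA: "M (A v) = v" for v
    by (simp_all add: M_def surj_f_inv_f[OF surjA] inv_f_f[OF injA])
  show ?thesis
  proof
    show "linear M"
    proof (rule linearI)
      show "M (u + v) = M u + M v" for u v
        using MA[of "M u + M v"] by (simp add: linear_add[OF linA] AM)
      show "M (r *\<^sub>R u) = r *\<^sub>R M u" for r u
        using MA[of "r *\<^sub>R M u"] by (simp add: linear_scale[OF linA] AM)
    qed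
    show "M (c *s v) = c *s M v" for c v
      using MA[of "c *s M v"] by (simp add: Ac AM)
    show "bij M" using AM MA by (intro o_bij[of A]) auto
    show "(norm (M u))\<^sup>2 = G u u" for u using nA[of "M u"] by (simp add: AM)
  qed
qed

section \<open>Cutoff, Taylor expansion and Cayley transform\<close>

text \<open>The cutoff is \<open>1 / (1 + k * Ln (1 + N * s))\<close>. The logarithm grows so slowly
  that the derivative times \<open>Re s\<close> stays below \<open>k\<close> for every
  \<open>N\<close>, while \<open>N\<close> can be taken large enough to make the values small from
  radius \<open>r\<close> on.\<close>

lemma slow_cutoff:
  fixes \<eta> m r :: real
  assumes "\<eta> > 0" "m > 0" "r > 0"
  obtains \<xi> \<xi>' :: "complex \<Rightarrow> complex" where
    "\<And>s. Re s > 0 \<Longrightarrow> (\<xi> has_field_derivative \<xi>' s) (at s)"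
    "\<And>s. Re s > 0 \<Longrightarrow> norm (\<xi>' s) * Re s \<le> \<eta>"
    "\<And>s. Re s > 0 \<Longrightarrow> 0 \<le> Re (\<xi> s) \<and> Re (\<xi> s) \<le> 1 \<and> \<bar>Im (\<xi> s)\<bar> \<le> \<eta>"
    "\<And>s. Re s > 0 \<Longrightarrow> norm s \<ge> r \<Longrightarrow> norm (\<xi> s) \<le> m"
    "\<And>\<epsilon>. \<epsilon> > 0 \<Longrightarrow> \<exists>d>0. \<forall>s. Re s > 0 \<longrightarrow> norm s < d \<longrightarrow> norm (\<xi> s - 1) \<le> \<epsilon>"
proof -
  \<comment> \<open>On the right half plane the imaginary part of \<open>Ln\<close> is at most 2 in
    absolute value, so this \<open>k\<close> keeps \<open>Im (D s)\<close> within \<eta>.\<close>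
  define k where "k = \<eta> / 2"
  \<comment> \<open>\<open>N\<close> solves \<open>k * ln (N * r) = 1 / m\<close>, which makes
    \<open>Re (D s)\<close> at least \<open>1 / m\<close> once \<open>norm s\<close> reaches
    \<open>r\<close>.\<close>
  define N where "N = exp (1 / (m * k)) / r"
  define E where "E s = 1 + of_real N * s" for s :: complex
  define D where "D s = 1 + of_real k * Ln (E s)" for s
  define \<xi> where "\<xi> s = 1 / D s" for s
  define \<xi>' where "\<xi>' s = - (of_real k * of_real N / E s) / (D s)^2" for s
  have k: "k > 0" and N: "N > 0" using assms by (auto simp: k_def N_def)
  have E: "Re (E s) > 1" "norm (E s) \<ge> 1" "norm (E s) \<ge> N * norm s" "norm (E s) \<ge> N * Re s" "E s \<noteq> 0" "E s \<notin> \<real>\<^sub>\<le>\<^sub>0"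
    if "Re s > 0" for s
  proof -
    show 1: "Re (E s) > 1" using that N by (simp add: E_def)
    then show "norm (E s) \<ge> 1" using complex_Re_le_cmod[of "E s"] by linarith
    show "E s \<noteq> 0" using 1 by auto
    show "E s \<notin> \<real>\<^sub>\<le>\<^sub>0" using 1 by (auto simp: complex_nonpos_Reals_iff)
    show "norm (E s) \<ge> N * Re s" using complex_Re_le_cmod[of "E s"] by (simp add: E_def)
    have "(norm (E s))^2 = 1 + 2 * N * Re s + (N * norm s)^2"
      by (simp add: E_def cmod_power2 power_mult_distrib) (simp add: power2_eq_square algebra_simps)
    also have "\<dots> \<ge> (N * norm s)^2" using that N by simp
    finally show "norm (E s) \<ge> N * norm s" by (rule power2_le_imp_le) simp
  qed
  have Dre: "Re (D s) = 1 + k * ln (norm (E s))" if "Re s > 0" for s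
    using E(5)[OF that] by (simp add: D_def)
  have D1: "Re (D s) \<ge> 1" if "Re s > 0" for s
    using Dre[OF that] E(2)[OF that] k by simp
  have Dim: "\<bar>Im (D s)\<bar> \<le> \<eta>" if "Re s > 0" for s
  proof -
    have "\<bar>Im (Ln (E s))\<bar> < pi / 2"
      using Re_Ln_pos_lt[OF E(5)[OF that]] E(1)[OF that] by auto
    then have "\<bar>Im (Ln (E s))\<bar> \<le> 2" using pi_less_4 by linarith
    then have "k * \<bar>Im (Ln (E s))\<bar> \<le> k * 2" using k by (intro mult_left_mono) auto
    then show ?thesis using k by (simp add: D_def abs_mult k_def)
  qed
  have Dn: "norm (D s) \<ge> 1" "norm (D s) \<ge> Re (D s)" "D s \<noteq> 0" if "Re s > 0" for s
    using D1[OF that] complex_Re_le_cmod[of "D s"] by auto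
  have d: "(\<xi> has_field_derivative \<xi>' s) (at s)" if "Re s > 0" for s
  proof -
    have "(E has_field_derivative of_real N) (at s)"
      unfolding E_def by (auto intro!: derivative_eq_intros)
    moreover have "(Ln has_field_derivative inverse (E s)) (at (E s))"
      using E(6)[OF that] by (rule has_field_derivative_Ln)
    ultimately have "((\<lambda>s. Ln (E s)) has_field_derivative inverse (E s) * of_real N) (at s)"
      by (intro DERIV_chain2)
    then have "(D has_field_derivative of_real k * (inverse (E s) * of_real N)) (at s)"
      unfolding D_def by (auto intro!: DERIV_cmult DERIV_cong[OF DERIV_add[OF DERIV_const]])
    then have "((\<lambda>s. 1 / D s) has_field_derivative \<xi>' s) (at s)"
      using Dn(3)[OF that] by (auto intro!: derivative_eq_intros simp: \<xi>'_def divide_simps power2_eq_square)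
    then show ?thesis unfolding \<xi>_def .
  qed
  have d': "norm (\<xi>' s) * Re s \<le> \<eta>" if "Re s > 0" for s
  proof -
    have "norm (\<xi>' s) = k * (N / norm (E s)) / (norm (D s))^2"
      using k N by (simp add: \<xi>'_def norm_divide norm_mult norm_power)
    also have "\<dots> \<le> k * (N / norm (E s)) / 1"
      using Dn[OF that] k N by (intro divide_left_mono) auto
    finally have "norm (\<xi>' s) * Re s \<le> k * (N / norm (E s)) * Re s"
      using that by (intro mult_right_mono) auto
    also have "\<dots> = k * (N * Re s / norm (E s))" by simp
    also have "\<dots> \<le> k * 1" using E(4,5)[OF that] k by (intro mult_left_mono) (auto simp: divide_simps)
    finally show ?thesis using assms(1) by (simp add: k_def)
  qed
  have b: "0 \<le> Re (\<xi> s) \<and> Re (\<xi> s) \<le> 1 \<and> \<bar>Im (\<xi> s)\<bar> \<le> \<eta>" if "Re s > 0" for s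
  proof -
    let ?D = "D s"
    have n1: "(norm ?D)^2 \<ge> 1" using Dn[OF that] by simp
    have re: "Re (\<xi> s) = Re ?D / (norm ?D)^2" and im: "Im (\<xi> s) = - Im ?D / (norm ?D)^2"
      by (simp_all add: \<xi>_def Re_divide Im_divide cmod_power2)
    have "norm (\<xi> s) \<le> 1" using Dn[OF that] by (simp add: \<xi>_def norm_divide divide_simps)
    then have "Re (\<xi> s) \<le> 1" using complex_Re_le_cmod[of "\<xi> s"] by linarith
    moreover have "Re (\<xi> s) \<ge> 0" using re D1[OF that] by simp
    moreover have "\<bar>Im (\<xi> s)\<bar> \<le> \<bar>Im ?D\<bar> / 1"
      unfolding im abs_divide abs_minus using n1 by (intro divide_left_mono) auto
    ultimately show ?thesis using Dim[OF that] by simp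
  qed
  have f: "norm (\<xi> s) \<le> m" if "Re s > 0" "norm s \<ge> r" for s
  proof -
    have "exp (1 / (m * k)) = N * r" using assms by (simp add: N_def)
    also have "\<dots> \<le> N * norm s" using that N by simp
    also have "\<dots> \<le> norm (E s)" using E(3)[OF that(1)] .
    finally have "1 / (m * k) \<le> ln (norm (E s))"
      using ln_ge_iff[of "norm (E s)"] E(5)[OF that(1)] by simp
    then have "k * (1 / (m * k)) \<le> k * ln (norm (E s))" using k by (intro mult_left_mono) auto
    then have "1 / m \<le> Re (D s)" using k assms by (simp add: Dre[OF that(1)])
    then have "1 / m \<le> norm (D s)" using Dn[OF that(1)] by linarith
    then show ?thesis using assms(2) Dn(3)[OF that(1)]
      by (simp add: \<xi>_def norm_divide divide_simps mult.commute)
  qed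
  have E0: "E 0 = 1" by (simp add: E_def)
  have "continuous (at 0) \<xi>"
    unfolding \<xi>_def D_def E_def by (intro continuous_intros continuous_at_Ln) (auto simp: complex_nonpos_Reals_iff)
  moreover have "\<xi> 0 = 1" by (simp add: \<xi>_def D_def E0)
  ultimately have "\<exists>d>0. \<forall>s. Re s > 0 \<longrightarrow> norm s < d \<longrightarrow> norm (\<xi> s - 1) \<le> \<epsilon>" if "\<epsilon> > 0" for \<epsilon>
    using that unfolding continuous_at_eps_delta by (metis diff_zero less_imp_le dist_norm)
  with d d' b f show ?thesis using that by blast
qed

text \<open>The linear term is taken at the moving point \<open>x\<close>, but the quadratic form is
  frozen at \<open>p\<close>, with an error uniform in both points. This works because
  \<open>D1 - D2 p\<close> has small derivative near \<open>p\<close> and so a small Lipschitz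
  constant there.\<close>

lemma C2_taylor:
  fixes \<rho> :: "'a::real_normed_vector \<Rightarrow> real"
  assumes "C2_defining_function U \<rho> D1" "open U" "p \<in> U"
  obtains H :: "'a \<Rightarrow> 'a \<Rightarrow> real" where
    "bounded_bilinear H"
    "\<And>e. e > 0 \<Longrightarrow> \<exists>r>0. ball p r \<subseteq> U \<and> (\<forall>x\<in>ball p r. \<forall>y\<in>ball p r.
        \<bar>\<rho> y - \<rho> x - D1 x (y - x) - H (y - x) (y - x) / 2\<bar> \<le> e * (norm (y - x))\<^sup>2)"
proof -
  obtain D2 :: "'a \<Rightarrow> ('a \<Rightarrow>\<^sub>L ('a \<Rightarrow>\<^sub>L real))" where
      d1: "\<And>x. x \<in> U \<Longrightarrow> (\<rho> has_derivative blinfun_apply (D1 x)) (at x)"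
      and d2: "\<And>x. x \<in> U \<Longrightarrow> (D1 has_derivative blinfun_apply (D2 x)) (at x)"
      and cont: "continuous_on U D2"
    using assms(1) unfolding C2_defining_function_def by blast
  define H where "H u v = blinfun_apply (blinfun_apply (D2 p) u) v" for u v
  have bil: "bounded_bilinear H"
    unfolding H_def
    using bounded_bilinear.comp1[OF bounded_bilinear_blinfun_apply blinfun.bounded_linear_right[of "D2 p"]] .
  have "\<exists>r>0. ball p r \<subseteq> U \<and> (\<forall>x\<in>ball p r. \<forall>y\<in>ball p r.
        \<bar>\<rho> y - \<rho> x - D1 x (y - x) - H (y - x) (y - x) / 2\<bar> \<le> e * (norm (y - x))\<^sup>2)" if e: "e > 0" for e
  proof -
    have "isCont D2 p" using cont assms by (simp add: continuous_on_eq_continuous_at)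
    then obtain r1 where r1: "r1 > 0" "\<And>x. dist x p < r1 \<Longrightarrow> dist (D2 x) (D2 p) < e"
      using e unfolding continuous_at_eps_delta by (auto simp: dist_norm)
    obtain r2 where r2: "r2 > 0" "ball p r2 \<subseteq> U" using assms open_contains_ball by blast
    define r where "r = min r1 r2"
    have r: "r > 0" "ball p r \<subseteq> U" using r1 r2 by (auto simp: r_def)
    have gr: "norm ((D1 y - D2 p y) - (D1 x - D2 p x)) \<le> e * norm (y - x)"
      if "x \<in> ball p r" "y \<in> ball p r" for x y
    proof (rule differentiable_bound[of "ball p r" "\<lambda>x. D1 x - D2 p x" "\<lambda>x v. D2 x v - D2 p v"])
      fix x assume x: "x \<in> ball p r"
      show "((\<lambda>x. D1 x - D2 p x) has_derivative (\<lambda>v. D2 x v - D2 p v)) (at x within ball p r)"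
        by (rule has_derivative_diff[OF has_derivative_at_withinI[OF d2] bounded_linear_imp_has_derivative])
          (use x r in \<open>auto intro: blinfun.bounded_linear_right\<close>)
      have "onorm (\<lambda>v. D2 x v - D2 p v) = norm (D2 x - D2 p)"
        by (simp add: norm_blinfun.rep_eq blinfun.diff_left[abs_def])
      also have "\<dots> \<le> e" using r1(2)[of x] x by (simp add: r_def dist_norm norm_minus_commute)
      finally show "onorm (\<lambda>v. D2 x v - D2 p v) \<le> e" .
    qed (use that in auto)
    have "\<bar>\<rho> y - \<rho> x - D1 x (y - x) - H (y - x) (y - x) / 2\<bar> \<le> e * (norm (y - x))\<^sup>2"
      if x: "x \<in> ball p r" and y: "y \<in> ball p r" for x y
    proof -
      define u where "u = y - x"
      \<comment> \<open>The value of \<rho> along the segment minus its quadratic model. Its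
        derivative is at most \<open>e * (norm u)\<^sup>2\<close> in absolute value, so the
        one-variable mean value theorem finishes.\<close>
      define \<psi> where "\<psi> t = \<rho> (x + t *\<^sub>R u) - t * D1 x u - t\<^sup>2 / 2 * H u u" for t :: real
      have mem: "x + t *\<^sub>R u \<in> ball p r" if "0 \<le> t" "t \<le> 1" for t
      proof -
        have "(1 - t) *\<^sub>R x + t *\<^sub>R y \<in> ball p r"
          using convex_ball[of p r] x y that unfolding convex_alt by blast
        then show ?thesis by (simp add: u_def algebra_simps)
      qed
      have der: "(\<psi> has_real_derivative (D1 (x + t *\<^sub>R u) u - D1 x u - t * H u u)) (at t)"
        if "0 \<le> t" "t \<le> 1" for t
      proof -
        have a: "((\<lambda>t. x + t *\<^sub>R u) has_derivative (\<lambda>s. s *\<^sub>R u)) (at t)"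
          by (auto intro!: derivative_eq_intros)
        have "x + t *\<^sub>R u \<in> U" using mem[OF that] r by blast
        from has_derivative_compose[OF a d1[OF this]]
        have "((\<lambda>t. \<rho> (x + t *\<^sub>R u)) has_derivative (\<lambda>s. D1 (x + t *\<^sub>R u) (s *\<^sub>R u))) (at t)" .
        then have "((\<lambda>t. \<rho> (x + t *\<^sub>R u)) has_real_derivative D1 (x + t *\<^sub>R u) u) (at t)"
          unfolding has_field_derivative_def
          by (rule has_derivative_eq_rhs) (auto simp: blinfun.scaleR_right)
        then show ?thesis unfolding \<psi>_def
          by (auto intro!: derivative_eq_intros)
      qed
      have bd: "\<bar>D1 (x + t *\<^sub>R u) u - D1 x u - t * H u u\<bar> \<le> e * (norm u)\<^sup>2"
        if "0 \<le> t" "t \<le> 1" for t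
      proof -
        let ?T = "(D1 (x + t *\<^sub>R u) - D2 p (x + t *\<^sub>R u)) - (D1 x - D2 p x)"
        have "norm ?T \<le> e * norm (t *\<^sub>R u)"
          using gr[OF x mem[OF that]] by simp
        also have "\<dots> \<le> e * norm u" using that e by (intro mult_left_mono) (auto intro: mult_left_le_one_le)
        finally have T: "norm ?T \<le> e * norm u" .
        have "D1 (x + t *\<^sub>R u) u - D1 x u - t * H u u = ?T u"
          by (simp add: H_def blinfun.add_right blinfun.scaleR_right blinfun.diff_left blinfun.add_left blinfun.scaleR_left)
        also have "norm \<dots> \<le> norm ?T * norm u" by (rule norm_blinfun)
        also have "\<dots> \<le> (e * norm u) * norm u" using T by (intro mult_right_mono) auto
        finally show ?thesis by (simp add: power2_eq_square)
      qed
      obtain t where t: "0 < t" "t < 1" and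
        "\<psi> 1 - \<psi> 0 = (1 - 0) * (D1 (x + t *\<^sub>R u) u - D1 x u - t * H u u)"
        using MVT2[of 0 1 \<psi> "\<lambda>t. D1 (x + t *\<^sub>R u) u - D1 x u - t * H u u"] der by auto
      then have "\<bar>\<psi> 1 - \<psi> 0\<bar> \<le> e * (norm u)\<^sup>2" using bd[of t] by simp
      moreover have "\<psi> 1 - \<psi> 0 = \<rho> y - \<rho> x - D1 x u - H u u / 2"
        by (simp add: \<psi>_def u_def)
      ultimately show ?thesis by (simp add: u_def)
    qed
    with r show ?thesis by blast
  qed
  with bil show ?thesis using that by blast
qed

text \<open>Here and in the next lemma \<open>m\<close> stands for the squared norm of the
  tangential coordinate and \<open>x\<close> for the cutoff value at \<open>s\<close>. With
  \<open>x\<close> almost 1, the positivity \<open>c * m \<le> lam\<close> bounds \<open>m\<close>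
  and \<open>norm s\<close> by multiples of \<open>norm (s - h * x)\<close>, which then absorbs the
  Taylor error.\<close>

lemma cutoff_near_bound:
  fixes s h x :: complex
  assumes c: "0 < c" "c \<le> 1" and C: "1 \<le> C" and m: "0 \<le> m"
    and h: "norm h \<le> C * m" and lam: "c * m \<le> lam"
    and taylor: "lam - \<epsilon> * (m + norm s) \<le> Re s - Re h"
    and x: "norm (x - 1) \<le> \<epsilon>" and eps: "0 \<le> \<epsilon>" "8 * C * \<epsilon> \<le> c"
  shows "lam - Re (s - h * x) \<le> 20 * C / c * \<epsilon> * norm (s - h * x)"
proof -
  let ?w = "s - h * x"
  have e1: "\<epsilon> \<le> 1"
  proof -
    have "8 * 1 * \<epsilon> \<le> 8 * C * \<epsilon>" using C eps by (intro mult_right_mono) auto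
    then show ?thesis using eps c by linarith
  qed
  have Cm: "0 \<le> C * m" using C m by simp
  have "norm x \<le> norm (x - 1) + norm (1 :: complex)" using norm_triangle_ineq[of "x - 1" 1] by simp
  then have x2: "norm x \<le> 2" using x e1 by simp
  have "norm (h * x) \<le> (C * m) * 2" unfolding norm_mult using h x2 Cm by (intro mult_mono) auto
  moreover have "norm s \<le> norm ?w + norm (h * x)" using norm_triangle_ineq[of ?w "h * x"] by simp
  ultimately have s: "norm s \<le> norm ?w + 2 * (C * m)" by simp
  have "\<bar>Re (h * (x - 1))\<bar> \<le> norm (h * (x - 1))" by (rule abs_Re_le_cmod)
  also have "\<dots> \<le> (C * m) * \<epsilon>" unfolding norm_mult using h x Cm by (intro mult_mono) auto
  finally have hx: "\<bar>Re (h * x) - Re h\<bar> \<le> (C * m) * \<epsilon>" by (simp add: algebra_simps)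
  have "\<epsilon> * norm s \<le> \<epsilon> * (norm ?w + 2 * (C * m))" using s eps by (intro mult_left_mono) auto
  moreover have "\<epsilon> * m \<le> \<epsilon> * (C * m)" using C m eps mult_right_mono[of 1 C m] by (intro mult_left_mono) auto
  moreover have "Re ?w = (Re s - Re h) - (Re (h * x) - Re h)" by simp
  ultimately have 1: "lam - Re ?w \<le> 4 * (\<epsilon> * (C * m)) + \<epsilon> * norm ?w"
    using taylor hx by (simp add: algebra_simps abs_le_iff)
  have "8 * C * \<epsilon> * m \<le> c * m" using eps m by (intro mult_right_mono) auto
  then have "4 * (\<epsilon> * (C * m)) \<le> c * m / 2" by (simp add: algebra_simps)
  moreover have "Re ?w \<le> norm ?w" by (rule complex_Re_le_cmod)
  moreover have "\<epsilon> * norm ?w \<le> 1 * norm ?w" using e1 by (intro mult_right_mono) auto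
  \<comment> \<open>The error terms in \<open>m\<close> use up only half of
    \<open>c * m \<le> lam\<close>; the other half shows that \<open>norm ?w\<close> controls
    \<open>m\<close>.\<close>
  ultimately have "c * m \<le> 4 * norm ?w" using 1 lam by simp
  then have "m \<le> 4 / c * norm ?w" using c by (simp add: field_simps)
  then have "4 * (\<epsilon> * (C * m)) \<le> 4 * (\<epsilon> * (C * (4 / c * norm ?w)))"
    using C eps by (intro mult_left_mono) auto
  with 1 have "lam - Re ?w \<le> (16 * C / c + 1) * (\<epsilon> * norm ?w)" by (simp add: algebra_simps)
  also have "\<dots> \<le> (20 * C / c) * (\<epsilon> * norm ?w)"
    using c C eps by (intro mult_right_mono) (auto simp: field_simps)
  finally show ?thesis by (simp add: mult.assoc)
qed

text \<open>The cutoff may take intermediate values here. Up to a term small with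
  \<open>Im x\<close>, the real part of \<open>s - h * x\<close> is a convex combination of
  \<open>Re s\<close> and \<open>Re s - Re h\<close>, both at least \<open>c * m\<close> up to the
  Taylor error. So \<open>s - h * x\<close> can be small only if \<open>m\<close>, and with it
  \<open>s\<close>, is small.\<close>

lemma cutoff_far_bound:
  fixes s h x :: complex
  assumes c: "0 < c" "c \<le> 1" and C: "1 \<le> C" and m: "0 \<le> m"
    and h: "norm h \<le> C * m" and lam: "c * m \<le> lam" and res: "c * m \<le> Re s"
    and taylor: "lam - \<epsilon> * (m + norm s) \<le> Re s - Re h"
    and x: "0 \<le> Re x" "Re x \<le> 1" "\<bar>Im x\<bar> \<le> \<eta>"
    and eps: "0 \<le> \<epsilon>" "8 * C * \<epsilon> \<le> c" and eta: "8 * C * \<eta> \<le> c"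
  shows "norm s \<le> (1 + 8 * C / c) * norm (s - h * x)"
proof -
  let ?w = "s - h * x"
  have eta0: "0 \<le> \<eta>" using x by linarith
  have small: "t \<le> 1 / 8" if "0 \<le> t" "8 * C * t \<le> c" for t
  proof -
    have "8 * 1 * t \<le> 8 * C * t" using C that by (intro mult_right_mono) auto
    then show ?thesis using that c by linarith
  qed
  have Cm: "0 \<le> C * m" using C m by simp
  have "norm x \<le> 2" using cmod_le[of x] x small[OF eta0 eta] by simp
  then have "norm (h * x) \<le> (C * m) * 2" unfolding norm_mult using h Cm by (intro mult_mono) auto
  moreover have "norm s \<le> norm ?w + norm (h * x)" using norm_triangle_ineq[of ?w "h * x"] by simp
  ultimately have s: "norm s \<le> norm ?w + 2 * (C * m)" by simp
  have "\<bar>Im h * Im x\<bar> \<le> (C * m) * \<eta>"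
    unfolding abs_mult using h x Cm abs_Im_le_cmod[of h] by (intro mult_mono) auto
  moreover have "8 * C * \<eta> * m \<le> c * m" using eta m by (intro mult_right_mono) auto
  ultimately have im: "\<bar>Im h * Im x\<bar> \<le> c * m / 8" by (simp add: algebra_simps)
  have e: "8 * C * \<epsilon> * m \<le> c * m" using eps m by (intro mult_right_mono) auto
  have m1: "\<epsilon> * m \<le> \<epsilon> * (C * m)" using C m eps mult_right_mono[of 1 C m] by (intro mult_left_mono) auto
  have "\<epsilon> * norm s \<le> \<epsilon> * (norm ?w + 2 * (C * m))" using s eps by (intro mult_left_mono) auto
  moreover have "\<epsilon> * norm ?w \<le> 1 * norm ?w" using small[OF eps] by (intro mult_right_mono) auto
  ultimately have es: "\<epsilon> * (m + norm s) \<le> 3 / 8 * (c * m) + norm ?w"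
    using e m1 by (simp add: algebra_simps)
  have es0: "0 \<le> \<epsilon> * (m + norm s)" using eps m by simp
  have "(1 - Re x) * (c * m) \<le> (1 - Re x) * Re s" using x res by (intro mult_left_mono) auto
  moreover have "Re x * (c * m - \<epsilon> * (m + norm s)) \<le> Re x * (Re s - Re h)"
    using taylor lam x by (intro mult_left_mono) auto
  moreover have "Re x * (\<epsilon> * (m + norm s)) \<le> 1 * (\<epsilon> * (m + norm s))"
    using x es0 by (intro mult_right_mono) auto
  moreover have "Re ?w = (1 - Re x) * Re s + Re x * (Re s - Re h) + Im h * Im x"
    by (simp add: algebra_simps)
  ultimately have "Re ?w \<ge> c * m - \<epsilon> * (m + norm s) - c * m / 8"
    using im by (simp add: algebra_simps abs_le_iff)
  then have "c * m / 2 \<le> 2 * norm ?w" using es complex_Re_le_cmod[of ?w] by linarith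
  then have "m \<le> 4 / c * norm ?w" using c by (simp add: field_simps)
  then have "2 * (C * m) \<le> 2 * (C * (4 / c * norm ?w))" using C by (intro mult_left_mono) auto
  with s show ?thesis by (simp add: algebra_simps)
qed

text \<open>Since \<open>norm h \<le> C * m\<close> and \<open>c * m \<le> Re z\<close>, the
  derivative of \<open>h * \<xi> z\<close> is at most \<open>C * \<eta> / c\<close>, hence at most
  1/2, on a convex set. The identity minus such a contraction is injective.\<close>

lemma cutoff_injective:
  fixes h :: complex
  assumes c: "0 < c" and C: "0 \<le> C" and m: "0 \<le> m" and h: "norm h \<le> C * m"
    and der: "\<And>s. Re s > 0 \<Longrightarrow> (\<xi> has_field_derivative \<xi>' s) (at s)"
    and bd: "\<And>s. Re s > 0 \<Longrightarrow> norm (\<xi>' s) * Re s \<le> \<eta>" and eta: "2 * C * \<eta> \<le> c"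
    and s: "Re s > 0" "c * m \<le> Re s" and t: "Re t > 0" "c * m \<le> Re t"
    and eq: "s - h * \<xi> s = t - h * \<xi> t"
  shows "s = t"
proof -
  let ?T = "{z. Re z > 0} \<inter> {z. c * m \<le> Re z}"
  have "convex ?T"
    by (intro convex_Int convex_halfspace_Re_gt) (simp add: convex_halfspace_Re_ge)
  moreover have "((\<lambda>z. h * \<xi> z) has_field_derivative h * \<xi>' z) (at z within ?T)" if "z \<in> ?T" for z
    using der[of z] that by (intro has_field_derivative_at_within[OF DERIV_cmult]) auto
  moreover have "norm (h * \<xi>' z) \<le> 1 / 2" if "z \<in> ?T" for z
  proof -
    have z: "Re z > 0" "c * m \<le> Re z" using that by auto
    have eta0: "0 \<le> \<eta>" using bd[OF z(1)] z(1) by (smt (verit) mult_nonneg_nonneg norm_ge_zero)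
    have "c * (norm h * norm (\<xi>' z)) \<le> c * (C * m * norm (\<xi>' z))"
      using c h by (intro mult_left_mono mult_right_mono) auto
    also have "\<dots> = C * (norm (\<xi>' z) * (c * m))" by simp
    also have "\<dots> \<le> C * (norm (\<xi>' z) * Re z)" using z C by (intro mult_left_mono) auto
    also have "\<dots> \<le> C * \<eta>" using bd[OF z(1)] C by (intro mult_left_mono) auto
    also have "\<dots> \<le> c * (1 / 2)" using eta by simp
    finally have "c * (norm h * norm (\<xi>' z)) \<le> c * (1 / 2)" .
    then show ?thesis using c by (simp only: norm_mult mult_le_cancel_left_pos)
  qed
  ultimately have "norm (h * \<xi> s - h * \<xi> t) \<le> 1 / 2 * norm (s - t)"
    using s t by (intro field_differentiable_bound[of ?T "\<lambda>z. h * \<xi> z" "\<lambda>z. h * \<xi>' z"]) auto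
  moreover have "h * \<xi> s - h * \<xi> t = s - t" using eq by (simp add: algebra_simps)
  ultimately show ?thesis by simp
qed

text \<open>Solves \<open>s = w + h * \<xi> s\<close> by Brouwer's theorem: where the cutoff is
  close to 1, the right-hand side maps a small ball about \<open>w + h\<close> into itself.\<close>

lemma cutoff_fixed_point:
  fixes h w :: complex
  assumes R: "0 \<le> R" and cont: "continuous_on (cball (w + h) R) \<xi>"
    and bd: "\<And>s. s \<in> cball (w + h) R \<Longrightarrow> norm h * norm (\<xi> s - 1) \<le> R"
  obtains s where "s \<in> cball (w + h) R" "s - h * \<xi> s = w"
proof -
  have "\<exists>s\<in>cball (w + h) R. w + h * \<xi> s = s"
  proof (rule brouwer[of "cball (w + h) R" "\<lambda>s. w + h * \<xi> s"])
    show "(\<lambda>s. w + h * \<xi> s) \<in> cball (w + h) R \<rightarrow> cball (w + h) R"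
    proof
      fix s assume s: "s \<in> cball (w + h) R"
      have "dist (w + h) (w + h * \<xi> s) = norm (h * (\<xi> s - 1))"
        by (simp add: dist_norm norm_minus_commute algebra_simps)
      then show "w + h * \<xi> s \<in> cball (w + h) R" using bd[OF s] by (simp add: norm_mult)
    qed
  qed (use R cont in \<open>auto intro!: continuous_intros\<close>)
  then show ?thesis using that by (metis add_diff_cancel_right')
qed

section \<open>The Cayley transform and its inverse\<close>

lemma norm_cayley_numerator:
  "(norm (w - a))\<^sup>2 = (norm (w + cnj a))\<^sup>2 - 4 * Re a * Re w"
  unfolding cmod_power2 by (simp add: power2_eq_square algebra_simps)

text \<open>With \<open>a\<close> close to the positive real axis and \<open>w\<close> almost in the
  right half plane, the cross term of the squared norm is at least
  \<open>- norm w * norm a / 2\<close>. The two squares sum to at least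
  \<open>2 * norm w * norm a\<close>, so the denominator cannot cancel.\<close>

lemma cayley_denominator:
  assumes "\<bar>Im a\<bar> \<le> norm a / 8" "0 < Re a" "- (norm w / 8) \<le> Re w"
  shows "norm w * norm a \<le> (norm (w + cnj a))\<^sup>2" "w + cnj a \<noteq> 0"
proof -
  have "Re w * Re a \<ge> - (norm w / 8) * norm a"
  proof (cases "Re w \<ge> 0")
    case True
    then show ?thesis using assms(2) by (smt (verit) mult_nonneg_nonneg mult_minus_left norm_ge_zero divide_nonneg_nonneg)
  next
    case False
    have "- Re w * Re a \<le> (norm w / 8) * norm a"
      using assms False complex_Re_le_cmod[of a] by (intro mult_mono) auto
    then show ?thesis by simp
  qed
  moreover have "\<bar>Im w * Im a\<bar> \<le> norm w * (norm a / 8)"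
    unfolding abs_mult using assms abs_Im_le_cmod[of w] by (intro mult_mono) auto
  moreover have "(norm (w + cnj a))\<^sup>2 = (norm w)\<^sup>2 + (norm a)\<^sup>2 + 2 * (Re w * Re a - Im w * Im a)"
    unfolding cmod_power2 by (simp add: power2_eq_square algebra_simps)
  ultimately have *: "(norm (w + cnj a))\<^sup>2 \<ge> (norm w)\<^sup>2 + (norm a)\<^sup>2 - norm w * norm a / 2"
    by (simp add: algebra_simps abs_le_iff)
  moreover have "0 \<le> (norm w - norm a)\<^sup>2" by simp
  moreover have "0 \<le> norm w * norm a" by simp
  ultimately show "norm w * norm a \<le> (norm (w + cnj a))\<^sup>2"
    unfolding power2_diff by linarith
  have "0 < norm a" using assms by auto
  then have "0 < (norm a)\<^sup>2 / 2" by simp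
  also have "\<dots> \<le> (norm (w + cnj a))\<^sup>2"
    using * zero_le_power2[of "norm w - norm a"] zero_le_power2[of "norm w"] zero_le_power2[of "norm a"]
    unfolding power2_diff by linarith
  finally show "w + cnj a \<noteq> 0" by auto
qed

text \<open>The surplus \<open>4 * Re a * (lam - Re w)\<close> is at most
  \<open>4 * \<epsilon> * norm a * norm w\<close>, and \<open>cayley_denominator\<close> bounds
  \<open>norm a * norm w\<close> by the squared denominator.\<close>

lemma cayley_near:
  assumes a: "\<bar>Im a\<bar> \<le> norm a / 8" "0 < Re a" and e: "0 \<le> \<epsilon>" "\<epsilon> \<le> 1 / 8" and lam: "0 \<le> lam"
    and w: "lam - Re w \<le> \<epsilon> * norm w"
  shows "w + cnj a \<noteq> 0" "(norm (w - a))\<^sup>2 + 4 * Re a * lam \<le> (1 + 4 * \<epsilon>) * (norm (w + cnj a))\<^sup>2"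
proof -
  have "\<epsilon> * norm w \<le> 1 / 8 * norm w" using e by (intro mult_right_mono) auto
  then have r: "- (norm w / 8) \<le> Re w" using w lam by linarith
  note d = cayley_denominator[OF a r]
  show "w + cnj a \<noteq> 0" by (rule d)
  have 1: "4 * Re a * (lam - Re w) \<le> 4 * Re a * (\<epsilon> * norm w)" using w a by (intro mult_left_mono) auto
  have "Re a * norm w \<le> norm a * norm w" by (intro mult_right_mono complex_Re_le_cmod) auto
  with d(1) have "Re a * norm w \<le> (norm (w + cnj a))\<^sup>2" by (simp add: mult.commute)
  then have "4 * \<epsilon> * (Re a * norm w) \<le> 4 * \<epsilon> * (norm (w + cnj a))\<^sup>2"
    using e by (intro mult_left_mono) auto
  with 1 have "4 * Re a * (lam - Re w) \<le> 4 * \<epsilon> * (norm (w + cnj a))\<^sup>2" by (simp only: mult_ac)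
  then show "(norm (w - a))\<^sup>2 + 4 * Re a * lam \<le> (1 + 4 * \<epsilon>) * (norm (w + cnj a))\<^sup>2"
    unfolding norm_cayley_numerator by (simp add: algebra_simps)
qed

text \<open>With \<open>w\<close> away from 0 and \<open>a\<close> small, the denominator has norm
  at least \<open>k / 2\<close>, while the surplus is at most \<open>4 * norm a * K\<close>;
  smallness of \<open>a\<close> makes it negligible.\<close>

lemma cayley_far:
  assumes k: "0 < k" "k \<le> norm w" and a: "norm a \<le> k / 2" "0 < Re a"
    and K: "lam - Re w \<le> K" "0 \<le> K" "16 * norm a * K \<le> \<epsilon> * k\<^sup>2" and e: "0 \<le> \<epsilon>"
  shows "w + cnj a \<noteq> 0" "(norm (w - a))\<^sup>2 + 4 * Re a * lam \<le> (1 + \<epsilon>) * (norm (w + cnj a))\<^sup>2"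
proof -
  have "norm w - norm (- cnj a) \<le> norm (w - - cnj a)" by (rule norm_triangle_ineq2)
  then have n: "k / 2 \<le> norm (w + cnj a)" using k a by simp
  then show "w + cnj a \<noteq> 0" using k by auto
  have "(k / 2)\<^sup>2 \<le> (norm (w + cnj a))\<^sup>2" using n k by (intro power_mono) auto
  then have "\<epsilon> * (k / 2)\<^sup>2 \<le> \<epsilon> * (norm (w + cnj a))\<^sup>2" using e by (intro mult_left_mono) auto
  moreover have "4 * Re a * (lam - Re w) \<le> 4 * norm a * K"
  proof -
    have "Re a * (lam - Re w) \<le> Re a * K" using K a by (intro mult_left_mono) auto
    also have "\<dots> \<le> norm a * K" using K complex_Re_le_cmod[of a] by (intro mult_right_mono) auto
    finally show ?thesis by simp
  qed
  ultimately show "(norm (w - a))\<^sup>2 + 4 * Re a * lam \<le> (1 + \<epsilon>) * (norm (w + cnj a))\<^sup>2"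
    using K(3) unfolding norm_cayley_numerator by (simp add: algebra_simps power_divide)
qed

text \<open>\<open>w\<close> solves \<open>\<alpha> = (w - a) / (w + cnj a)\<close>, and
  \<open>lam\<close> is the Levi value belonging to tangential size \<open>t\<close>. The distance
  of the data from the unit sphere becomes the margin \<open>Re w - lam\<close>, proportional to
  \<open>norm w\<close>, that later absorbs the Taylor errors.\<close>

lemma cayley_inverse:
  assumes a: "\<bar>Im a\<bar> \<le> norm a / 8" "0 < Re a" and e: "0 < e" "e < 1"
    and t: "0 \<le> t" and al: "(norm \<alpha>)\<^sup>2 + t < (1 - e)\<^sup>2"
  defines "w \<equiv> (a + cnj a * \<alpha>) / (1 - \<alpha>)" and "lam \<equiv> Re a * t / (norm (1 - \<alpha>))\<^sup>2"
  shows "1 - \<alpha> \<noteq> 0" "w + cnj a = of_real (2 * Re a) / (1 - \<alpha>)" "w - a = \<alpha> * (w + cnj a)"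
    "norm w \<le> 2 * norm a / e" "0 < Re w - lam" "e / 4 * norm w \<le> Re w - lam"
proof -
  have "(norm \<alpha>)\<^sup>2 < (1 - e)\<^sup>2" using al t by linarith
  then have n: "norm \<alpha> < 1 - e" using e by (simp add: power2_less_imp_less)
  have "norm (1 :: complex) - norm \<alpha> \<le> norm (1 - \<alpha>)" by (rule norm_triangle_ineq2)
  then have n1: "e \<le> norm (1 - \<alpha>)" using n by simp
  then show nz: "1 - \<alpha> \<noteq> 0" using e by auto
  have aa: "a + cnj a = of_real (2 * Re a)" by (simp add: complex_eq_iff)
  have "w + cnj a = (a + cnj a) / (1 - \<alpha>)"
    using nz by (simp add: w_def field_simps)
  then show den: "w + cnj a = of_real (2 * Re a) / (1 - \<alpha>)" by (simp only: aa)
  have "w - a = \<alpha> * (a + cnj a) / (1 - \<alpha>)"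
    using nz by (simp add: w_def field_simps)
  then show num: "w - a = \<alpha> * (w + cnj a)" unfolding den aa by simp
  have "norm (a + cnj a * \<alpha>) \<le> norm a + norm a * norm \<alpha>"
    using norm_triangle_ineq[of a "cnj a * \<alpha>"] by (simp add: norm_mult)
  also have "\<dots> \<le> norm a + norm a * 1" using n e by (intro add_left_mono mult_left_mono) auto
  finally have "norm w \<le> (2 * norm a) / norm (1 - \<alpha>)"
    unfolding w_def norm_divide by (intro divide_right_mono) auto
  also have "\<dots> \<le> 2 * norm a / e" using n1 e by (intro divide_left_mono mult_pos_pos) auto
  finally show "norm w \<le> 2 * norm a / e" .
  define d where "d = norm (w + cnj a)"
  have d: "d = 2 * Re a / norm (1 - \<alpha>)" using a by (simp add: d_def den norm_divide)
  have d0: "d > 0" using a nz by (simp add: d)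
  have "4 * Re a * lam = t * d\<^sup>2" unfolding lam_def d by (simp add: power_divide power2_eq_square)
  moreover have "(norm (w - a))\<^sup>2 = (norm \<alpha>)\<^sup>2 * d\<^sup>2" unfolding num d_def norm_mult power_mult_distrib ..
  ultimately have "d\<^sup>2 - 4 * Re a * (Re w - lam) = ((norm \<alpha>)\<^sup>2 + t) * d\<^sup>2"
    using norm_cayley_numerator[of w a] by (simp add: d_def algebra_simps)
  also have "\<dots> \<le> (1 - e)\<^sup>2 * d\<^sup>2" using al by (intro mult_right_mono) auto
  also have "\<dots> \<le> (1 - e) * d\<^sup>2" using e by (intro mult_right_mono) (auto simp: power2_eq_square mult_left_le)
  finally have key: "e * d\<^sup>2 \<le> 4 * Re a * (Re w - lam)" by (simp add: algebra_simps)
  moreover have "0 < e * d\<^sup>2" using e d0 by simp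
  ultimately have "0 < 4 * Re a * (Re w - lam)" by linarith
  then show pos: "0 < Re w - lam" using a by (simp add: zero_less_mult_iff)
  have "0 \<le> lam" using a t by (simp add: lam_def)
  then have "0 < Re w" using pos by linarith
  then have "- (norm w / 8) \<le> Re w" using norm_ge_zero[of w] by linarith
  then have "norm w * norm a \<le> d\<^sup>2" unfolding d_def by (rule cayley_denominator(1)[OF a])
  moreover have "norm w * Re a \<le> norm w * norm a" by (intro mult_left_mono complex_Re_le_cmod) auto
  ultimately have "e * (norm w * Re a) \<le> e * d\<^sup>2" using e by (intro mult_left_mono) auto
  with key have "Re a * (e * norm w) \<le> Re a * (4 * (Re w - lam))" by (simp add: algebra_simps)
  then show "e / 4 * norm w \<le> Re w - lam" using a by simp
qed

section \<open>Almost ball maps for a boundary in Levi normal form\<close>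

text \<open>The form \<open>ell x\<close> follows the boundary point, whereas \<open>P\<close>,
  \<open>lev\<close> and \<open>h\<close> are frozen at \<open>p\<close>, whose complex tangent
  space is the kernel of \<open>ell p\<close>. The error in \<open>taylor\<close> is quadratic in
  the tangential and linear in the normal coordinate, matching the homogeneity of a Siegel half
  space.\<close>

locale levi_normal_form =
  fixes \<Omega> :: "(complex^'n) set" and p \<nu> :: "complex^'n" and \<rho> :: "complex^'n \<Rightarrow> real"
    and ell :: "complex^'n \<Rightarrow> complex^'n \<Rightarrow> complex" and P M :: "complex^'n \<Rightarrow> complex^'n"
    and lev :: "complex^'n \<Rightarrow> real" and h :: "complex^'n \<Rightarrow> complex" and c C :: real
  assumes bounded_domain: "bounded \<Omega>"
    and ell_clinear: "\<And>x. clinear_form (ell x)"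
    and norm_nu: "norm \<nu> = 1" and ell_nu: "ell p \<nu> = 1"
    and ell_le: "\<And>u. norm (ell p u) \<le> norm u"
    and ell_cont: "\<And>e. e > 0 \<Longrightarrow> \<exists>r>0. \<forall>x\<in>ball p r. \<forall>u. norm (ell x u - ell p u) \<le> e * norm u"
    and P_def: "\<And>u. P u = u - ell p u *s \<nu>"
    and P_le: "\<And>u. norm (P u) \<le> norm u"
    and c: "0 < c" "c \<le> 1" and C: "1 \<le> C"
    and lev_scale: "\<And>k z. lev (k *s z) = (norm k)\<^sup>2 * lev z"
    and lev_ge: "\<And>z. ell p z = 0 \<Longrightarrow> c * (norm z)\<^sup>2 \<le> lev z"
    and lev_le: "\<And>z. ell p z = 0 \<Longrightarrow> lev z \<le> C * (norm z)\<^sup>2"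
    and h_le: "\<And>z. ell p z = 0 \<Longrightarrow> norm (h z) \<le> C * (norm z)\<^sup>2"
    and lev_h_ge: "\<And>z. ell p z = 0 \<Longrightarrow> c * (norm z)\<^sup>2 \<le> lev z + Re (h z)"
    and h_holo: "\<And>x v. holo_at (\<lambda>v. h (P (v - x))) v"
    and M_linear: "linear M" and M_scale: "\<And>k v. M (k *s v) = k *s M v" and M_bij: "bij M"
    and M_norm: "\<And>u. (norm (M u))\<^sup>2 = lev (P u) + (norm (ell p u))\<^sup>2"
    and taylor: "\<And>e. e > 0 \<Longrightarrow> \<exists>r>0. \<forall>x\<in>ball p r. \<rho> x = 0 \<longrightarrow> (\<forall>v\<in>ball p r. (v \<in> \<Omega> \<longleftrightarrow> \<rho> v < 0) \<and>
        \<bar>\<rho> v + Re (ell x (v - x)) - lev (P (v - x)) - Re (h (P (v - x)))\<bar>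
          \<le> e * ((norm (P (v - x)))\<^sup>2 + norm (ell x (v - x))))"
    and supporting: "\<exists>r>0. \<forall>x\<in>ball p r. \<rho> x = 0 \<longrightarrow> (\<forall>v\<in>\<Omega>. c * (norm (v - x))\<^sup>2 \<le> Re (ell x (v - x)))"
    and boundary_below: "\<And>r. r > 0 \<Longrightarrow> \<exists>d>0. \<forall>q\<in>\<Omega> \<inter> ball p d.
        \<exists>t. 0 < t \<and> t < r \<and> q - t *\<^sub>R \<nu> \<in> ball p r \<and> \<rho> (q - t *\<^sub>R \<nu>) = 0"
begin

lemma ell_add: "ell x (u + v) = ell x u + ell x v"
  and ell_diff: "ell x (u - v) = ell x u - ell x v"
  and ell_scale: "ell x (k *s u) = k * ell x u"
  using ell_clinear[of x]
  by (auto simp: clinear_form_def linear_conv_bounded_linear[symmetric] linear_add linear_diff)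

lemma ell_P [simp]: "ell p (P u) = 0"
  by (simp add: P_def ell_diff ell_scale ell_nu)

lemma P_of: "ell p z = 0 \<Longrightarrow> P (k *s \<nu> + z) = z"
  by (simp add: P_def ell_add ell_scale ell_nu)

lemma P_decomp: "u = ell p u *s \<nu> + P u"
  by (simp add: P_def)

lemma lev_nonneg: "ell p z = 0 \<Longrightarrow> 0 \<le> lev z"
  using lev_ge[of z] c by (smt (verit) mult_nonneg_nonneg zero_le_power2)

lemma h_zero: "h 0 = 0"
  using h_le[of 0] ell_scale[of p 0 0] by simp

text \<open>The sheared normal coordinate: where the cutoff is near 1, passing from
  \<open>ell x (v - x)\<close> to it removes \<open>Re (h z)\<close> from the quadratic
  expansion.\<close>

definition W :: "(complex \<Rightarrow> complex) \<Rightarrow> complex^'n \<Rightarrow> complex^'n \<Rightarrow> complex" where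
  "W \<xi> x v = ell x (v - x) - h (P (v - x)) * \<xi> (ell x (v - x))"

text \<open>The size estimates are left to the hypotheses \<open>into\<close> and
  \<open>onto\<close>. What remains is the algebra of the Cayley transform, with \<open>M\<close>
  turning \<open>lev\<close> plus the squared modulus of the normal coordinate into the squared
  Euclidean norm.\<close>

lemma almost_ball_map:
  fixes x :: "complex^'n" and t e :: real and \<xi> \<xi>' :: "complex \<Rightarrow> complex"
  defines "a \<equiv> ell x (t *\<^sub>R \<nu>)"
  assumes e: "0 < e" "e < 1" and x: "x \<notin> \<Omega>"
    and supp: "\<And>v. v \<in> \<Omega> \<Longrightarrow> c * (norm (v - x))\<^sup>2 \<le> Re (ell x (v - x))"
    and der: "\<And>s. Re s > 0 \<Longrightarrow> (\<xi> has_field_derivative \<xi>' s) (at s)"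
    and bd: "\<And>s. Re s > 0 \<Longrightarrow> norm (\<xi>' s) * Re s \<le> \<eta>" and eta: "2 * C * \<eta> \<le> c"
    and a: "0 < Re a" "\<bar>Im a\<bar> \<le> norm a / 8"
    and into: "\<And>v. v \<in> \<Omega> \<Longrightarrow> W \<xi> x v + cnj a \<noteq> 0 \<and> (norm (W \<xi> x v - a))\<^sup>2 + 4 * Re a * lev (P (v - x))
        \<le> (1 + e) * (norm (W \<xi> x v + cnj a))\<^sup>2"
    and onto: "\<And>z w. ell p z = 0 \<Longrightarrow> norm w \<le> 2 * norm a / e \<Longrightarrow> 0 < Re w - lev z \<Longrightarrow>
        e / 4 * norm w \<le> Re w - lev z \<Longrightarrow> \<exists>v\<in>\<Omega>. P (v - x) = z \<and> W \<xi> x v = w"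
  shows "\<exists>f :: complex^'n \<Rightarrow> complex^'n. holomorphic_map_on f \<Omega> \<and> inj_on f \<Omega> \<and> f (x + t *\<^sub>R \<nu>) = 0 \<and>
      (\<forall>v\<in>\<Omega>. (norm (f v))\<^sup>2 \<le> 1 + e) \<and> ball 0 (1 - e) \<subseteq> f ` \<Omega>"
proof -
  define A where "A v = (W \<xi> x v - a) / (W \<xi> x v + cnj a)" for v
  \<comment> \<open>The squared modulus of \<open>b\<close> is \<open>4 * Re a\<close>, so that the
    squared norm of \<open>f\<close> becomes the quotient estimated in \<open>into\<close>.\<close>
  define b where "b = complex_of_real (2 * sqrt (Re a))"
  define B where "B v = b / (W \<xi> x v + cnj a)" for v
  define f where "f v = M (A v *s \<nu> + B v *s P (v - x))" for v
  have b: "b \<noteq> 0" "(norm b)\<^sup>2 = 4 * Re a" using a by (auto simp: b_def norm_mult power_mult_distrib)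
  have pos: "Re (ell x (v - x)) > 0" if "v \<in> \<Omega>" for v
  proof -
    have "v \<noteq> x" using that x by auto
    then have "0 < c * (norm (v - x))\<^sup>2" using c by simp
    then show ?thesis using supp[OF that] by linarith
  qed
  have nz: "W \<xi> x v + cnj a \<noteq> 0" if "v \<in> \<Omega>" for v using into that by blast
  have PB: "ell p (B v *s P (v - x)) = 0" for v by (simp add: ell_scale)
  have coord: "ell p (A v *s \<nu> + B v *s P (v - x)) = A v" "P (A v *s \<nu> + B v *s P (v - x)) = B v *s P (v - x)" for v
    by (simp_all add: ell_add ell_scale ell_nu P_of PB)
  have Wh: "holo_at (W \<xi> x) v" if "v \<in> \<Omega>" for v
    unfolding W_def[abs_def]
    by (intro holo_at_diff holo_at_mult h_holo holo_at_linear[OF ell_clinear]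
        holo_at_compose[OF holo_at_linear[OF ell_clinear] der[OF pos[OF that]]])
  have hP: "holomorphic_map_on (\<lambda>v. P (v - x)) \<Omega>"
  proof (rule holomorphic_map_linear[OF holomorphic_map_translate])
    show "bounded_linear P"
      unfolding linear_conv_bounded_linear[symmetric]
      by (rule linearI) (simp_all add: P_def ell_add scaleR_eq_complex_scale ell_scale vec_eq_iff algebra_simps)
    show "P (k *s v) = k *s P v" for k v
      by (simp add: P_def ell_scale vec_eq_iff algebra_simps)
  qed
  have hA: "holo_at A v" and hB: "holo_at B v" if "v \<in> \<Omega>" for v
    unfolding A_def[abs_def] B_def[abs_def]
    by (intro holo_at_divide holo_at_diff holo_at_add holo_at_const Wh nz that)+
  have "bounded_linear M" using M_linear by (simp add: linear_conv_bounded_linear)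
  from holomorphic_map_linear[OF holomorphic_map_add[OF holomorphic_map_scale[OF hA holomorphic_map_const]
        holomorphic_map_scale[OF hB hP]] this M_scale]
  have "holomorphic_map_on f \<Omega>" unfolding f_def .
  moreover have "inj_on f \<Omega>"
  proof (rule inj_onI)
    fix v v' assume v: "v \<in> \<Omega>" "v' \<in> \<Omega>" and eq: "f v = f v'"
    have eq': "A v *s \<nu> + B v *s P (v - x) = A v' *s \<nu> + B v' *s P (v' - x)"
      using eq M_bij unfolding f_def by (meson bij_def injD)
    \<comment> \<open>The normal component recovers \<open>W\<close>, because the Cayley transform
      is injective when \<open>a + cnj a\<close> is nonzero. The tangential component then recovers
      \<open>P (v - x)\<close>, and \<open>cutoff_injective\<close> recovers
      \<open>ell x (v - x)\<close>.\<close>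
    have "A v = A v'" using arg_cong[OF eq', of "ell p"] by (simp add: coord)
    then have "(W \<xi> x v - a) * (W \<xi> x v' + cnj a) = (W \<xi> x v' - a) * (W \<xi> x v + cnj a)"
      using nz v by (simp add: A_def frac_eq_eq)
    then have "(a + cnj a) * (W \<xi> x v - W \<xi> x v') = 0" by (simp add: algebra_simps)
    moreover have "a + cnj a \<noteq> 0" using a by (auto simp: complex_eq_iff)
    ultimately have Weq: "W \<xi> x v = W \<xi> x v'" by simp
    have "B v *s P (v - x) = B v' *s P (v' - x)" using arg_cong[OF eq', of P] by (simp add: coord)
    then have Peq: "P (v - x) = P (v' - x)"
      using Weq b nz[OF v(1)] by (simp add: B_def)
    have m: "c * (norm (P (v - x)))\<^sup>2 \<le> Re (ell x (v - x))" if "v \<in> \<Omega>" for v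
    proof -
      have "c * (norm (P (v - x)))\<^sup>2 \<le> c * (norm (v - x))\<^sup>2"
        using c P_le by (intro mult_left_mono power_mono) auto
      then show ?thesis using supp[OF that] by linarith
    qed
    have "ell x (v - x) = ell x (v' - x)"
    proof (rule cutoff_injective[where h = "h (P (v - x))" and m = "(norm (P (v - x)))\<^sup>2", OF c(1) _ _ h_le[OF ell_P] der bd eta])
      show "ell x (v - x) - h (P (v - x)) * \<xi> (ell x (v - x)) = ell x (v' - x) - h (P (v - x)) * \<xi> (ell x (v' - x))"
        using Weq Peq by (simp add: W_def)
      show "c * (norm (P (v - x)))\<^sup>2 \<le> Re (ell x (v' - x))" using m[OF v(2)] Peq by simp
    qed (use C m v pos in auto)
    then have "ell x (v - v') = 0" by (simp add: ell_diff)
    \<comment> \<open>The two points can now differ only along the complex line of \<nu>, on which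
      \<open>ell x\<close> does not vanish.\<close>
    moreover have "v - v' = ell p (v - v') *s \<nu>"
      using Peq by (simp add: P_def ell_diff vec_eq_iff algebra_simps)
    ultimately have "ell p (v - v') * ell x \<nu> = 0" using ell_scale[of x "ell p (v - v')" \<nu>] by simp
    moreover have "ell x \<nu> \<noteq> 0"
      using a by (auto simp: a_def scaleR_eq_complex_scale ell_scale)
    ultimately have "ell p (v - v') = 0" by simp
    then show "v = v'" using \<open>v - v' = ell p (v - v') *s \<nu>\<close> by simp
  qed
  moreover have "f (x + t *\<^sub>R \<nu>) = 0"
  proof -
    have P0: "P (t *\<^sub>R \<nu>) = 0" by (simp add: P_def scaleR_eq_complex_scale ell_scale ell_nu)
    then have "W \<xi> x (x + t *\<^sub>R \<nu>) = a" by (simp add: W_def h_zero a_def)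
    then show ?thesis using P0 M_linear by (simp add: f_def A_def linear_0)
  qed
  moreover have "(norm (f v))\<^sup>2 \<le> 1 + e" if v: "v \<in> \<Omega>" for v
  proof -
    let ?d = "W \<xi> x v + cnj a"
    have d: "(norm ?d)\<^sup>2 > 0" using nz[OF v] by simp
    have "(norm (f v))\<^sup>2 = (norm (B v))\<^sup>2 * lev (P (v - x)) + (norm (A v))\<^sup>2"
      by (simp add: f_def M_norm coord lev_scale)
    also have "\<dots> = ((norm (W \<xi> x v - a))\<^sup>2 + 4 * Re a * lev (P (v - x))) / (norm ?d)\<^sup>2"
      by (simp add: A_def B_def norm_divide power_divide b(2) add_divide_distrib)
    also have "\<dots> \<le> 1 + e" using into[OF v] d by (simp add: divide_le_eq)
    finally show ?thesis .
  qed
  moreover have "ball 0 (1 - e) \<subseteq> f ` \<Omega>"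
  proof
    fix y :: "complex^'n" assume y: "y \<in> ball 0 (1 - e)"
    obtain Y where Y: "M Y = y" using bij_is_surj[OF M_bij] surjD by metis
    define \<alpha> where "\<alpha> = ell p Y"
    define w where "w = (a + cnj a * \<alpha>) / (1 - \<alpha>)"
    \<comment> \<open>The solution of \<open>B v *s z = P Y\<close>: by
      \<open>cayley_inverse\<close> the quotient \<open>(w + cnj a) / b\<close> equals
      \<open>sqrt (Re a) / (1 - \<alpha>)\<close>.\<close>
    define z where "z = (complex_of_real (sqrt (Re a)) / (1 - \<alpha>)) *s P Y"
    have "(norm y)\<^sup>2 < (1 - e)\<^sup>2" using y by (intro power_strict_mono) auto
    then have 1: "(norm \<alpha>)\<^sup>2 + lev (P Y) < (1 - e)\<^sup>2"
      using M_norm[of Y] Y by (simp add: \<alpha>_def)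
    note ci = cayley_inverse[OF a(2,1) e lev_nonneg[OF ell_P] 1, folded w_def]
    have lz: "lev z = Re a * lev (P Y) / (norm (1 - \<alpha>))\<^sup>2"
      using a by (simp add: z_def lev_scale norm_divide power_divide)
    obtain v where v: "v \<in> \<Omega>" "P (v - x) = z" "W \<xi> x v = w"
      using onto[of z w] ci(4-6) unfolding lz by (auto simp: z_def ell_scale)
    have "A v = \<alpha>" using ci(3) nz[OF v(1)] by (simp add: A_def v)
    moreover have "B v *s P (v - x) = P Y"
    proof -
      have "B v * (complex_of_real (sqrt (Re a)) / (1 - \<alpha>)) = b * of_real (sqrt (Re a)) / of_real (2 * Re a)"
        unfolding B_def v(3) ci(2) using ci(1) a by (simp add: field_simps)
      also have "b * of_real (sqrt (Re a)) = of_real (2 * Re a)"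
      proof -
        have "2 * sqrt (Re a) * sqrt (Re a) = 2 * Re a" using a by simp
        then show ?thesis unfolding b_def of_real_mult[symmetric] by (simp only:)
      qed
      finally show ?thesis using a unfolding v(2) z_def vector_smult_assoc by simp
    qed
    ultimately have "f v = M (ell p Y *s \<nu> + P Y)" by (simp only: f_def \<alpha>_def)
    then have "f v = y" using Y by (simp only: P_decomp[of Y, symmetric])
    then show "y \<in> f ` \<Omega>" using v by blast
  qed
  ultimately show ?thesis by blast
qed

text \<open>Order of the choices: a rough Taylor precision \<open>k\<close> with radius
  \<open>r0\<close>, a cutoff adapted to \<open>r0\<close>, a finer precision \<epsilon> with radius
  \<open>r1\<close>, and last a bound on the height \<open>t\<close>, which makes the Cayley
  parameter small against everything else.\<close>

lemma almost_ball_near: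
  assumes e: "0 < e" "e < 1"
  shows "\<exists>r>0. \<forall>q\<in>\<Omega> \<inter> ball p r. \<exists>f :: complex^'n \<Rightarrow> complex^'n.
    holomorphic_map_on f \<Omega> \<and> inj_on f \<Omega> \<and> f q = 0 \<and>
      (\<forall>v\<in>\<Omega>. (norm (f v))\<^sup>2 \<le> 1 + e) \<and> ball 0 (1 - e) \<subseteq> f ` \<Omega>"
proof -
  obtain rs where rs: "rs > 0" "\<And>x v. x \<in> ball p rs \<Longrightarrow> \<rho> x = 0 \<Longrightarrow> v \<in> \<Omega> \<Longrightarrow>
      c * (norm (v - x))\<^sup>2 \<le> Re (ell x (v - x))"
    using supporting by blast
  \<comment> \<open>This value meets both the precision required by \<open>cutoff_far_bound\<close>
    and the oscillation bound required by \<open>cutoff_injective\<close>.\<close>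
  define k where "k = c / (8 * C)"
  have k: "0 < k" "8 * C * k = c" using c C by (auto simp: k_def)
  obtain r0 where r0: "r0 > 0" and T0: "\<And>x v. x \<in> ball p r0 \<Longrightarrow> \<rho> x = 0 \<Longrightarrow> v \<in> ball p r0 \<Longrightarrow> (v \<in> \<Omega> \<longleftrightarrow> \<rho> v < 0) \<and>
        \<bar>\<rho> v + Re (ell x (v - x)) - lev (P (v - x)) - Re (h (P (v - x)))\<bar>
          \<le> k * ((norm (P (v - x)))\<^sup>2 + norm (ell x (v - x)))"
    using taylor[OF k(1)] by blast
  obtain rl where rl: "rl > 0" and ellx: "\<And>x u. x \<in> ball p rl \<Longrightarrow> norm (ell x u - ell p u) \<le> 1 / 16 * norm u"
    using ell_cont[of "1 / 16"] by auto
  \<comment> \<open>By \<open>supporting\<close>, a point of the domain at distance at least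
    \<open>r0 / 2\<close> from \<open>x\<close> has normal coordinate of modulus at least
    \<open>r2\<close>. Out there the rough expansion is lost, so the cutoff has to be small.\<close>
  define r2 where "r2 = c * (r0 / 2)\<^sup>2"
  have r2: "r2 > 0" using c r0 by (simp add: r2_def)
  obtain \<xi> \<xi>' where der: "\<And>s. Re s > 0 \<Longrightarrow> (\<xi> has_field_derivative \<xi>' s) (at s)"
    and bd: "\<And>s. Re s > 0 \<Longrightarrow> norm (\<xi>' s) * Re s \<le> k"
    and rng: "\<And>s. Re s > 0 \<Longrightarrow> 0 \<le> Re (\<xi> s) \<and> Re (\<xi> s) \<le> 1 \<and> \<bar>Im (\<xi> s)\<bar> \<le> k"
    and small: "\<And>s. Re s > 0 \<Longrightarrow> norm s \<ge> r2 \<Longrightarrow> norm (\<xi> s) \<le> c / (2 * C)"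
    and lim: "\<And>\<epsilon>. \<epsilon> > 0 \<Longrightarrow> \<exists>d>0. \<forall>s. Re s > 0 \<longrightarrow> norm s < d \<longrightarrow> norm (\<xi> s - 1) \<le> \<epsilon>"
  proof -
    have "0 < c / (2 * C)" using c C by simp
    from slow_cutoff[OF k(1) this r2] show ?thesis using that by blast
  qed
  \<comment> \<open>Chosen so that the loss in \<open>cutoff_near_bound\<close> is exactly
    \<open>e / 8\<close>.\<close>
  define \<epsilon> where "\<epsilon> = e * c / (160 * C)"
  have eps0: "\<epsilon> > 0" and eps1: "20 * C / c * \<epsilon> = e / 8" using e c C by (auto simp: \<epsilon>_def)
  have eps2: "8 * C * \<epsilon> \<le> c"
  proof -
    have "8 * C * \<epsilon> = e / 20 * c" using C by (simp add: \<epsilon>_def)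
    also have "\<dots> \<le> 1 * c" using e c by (intro mult_right_mono) auto
    finally show ?thesis by simp
  qed
  obtain d1 where d1: "d1 > 0" "\<And>s. Re s > 0 \<Longrightarrow> norm s < d1 \<Longrightarrow> norm (\<xi> s - 1) \<le> \<epsilon>"
    using lim[OF eps0] by blast
  obtain r1 where r1: "r1 > 0" and T1: "\<And>x v. x \<in> ball p r1 \<Longrightarrow> \<rho> x = 0 \<Longrightarrow> v \<in> ball p r1 \<Longrightarrow> (v \<in> \<Omega> \<longleftrightarrow> \<rho> v < 0) \<and>
        \<bar>\<rho> v + Re (ell x (v - x)) - lev (P (v - x)) - Re (h (P (v - x)))\<bar>
          \<le> \<epsilon> * ((norm (P (v - x)))\<^sup>2 + norm (ell x (v - x)))"
    using taylor[OF eps0] by blast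
  \<comment> \<open>Below \<open>d\<close> the cutoff is \<epsilon>-close to 1, and
    \<open>supporting\<close> keeps the point in the ball of the fine expansion.\<close>
  define d where "d = min d1 (c * (r1 / 2)\<^sup>2)"
  \<comment> \<open>Lower bound for \<open>norm w\<close> once \<open>norm s\<close> is at least
    \<open>d\<close>: the first entry serves points at distance at least \<open>r0 / 2\<close> from
    \<open>x\<close>, the second the closer ones.\<close>
  define \<kappa> where "\<kappa> = min (r2 / 2) (d / (1 + 8 * C / c))"
  have d: "d > 0" using d1 c r1 by (simp add: d_def)
  have Cc: "1 + 8 * C / c > 0" using c C by (intro add_pos_pos) auto
  have kap: "\<kappa> > 0" using r2 d Cc by (simp add: \<kappa>_def)
  obtain D0 where D0: "\<And>v. v \<in> \<Omega> \<Longrightarrow> dist p v \<le> D0"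
    using bounded_domain bounded_any_center[of \<Omega> p] by blast
  define D where "D = max D0 0 + 1"
  \<comment> \<open>Bounds \<open>lev z - Re w\<close> on the whole domain: the normal coordinate
    contributes at most \<open>2 * D\<close>, the shear \<open>2 * C * D\<^sup>2\<close> and
    \<open>lev z\<close> another \<open>C * D\<^sup>2\<close>.\<close>
  define K where "K = 2 * D + 3 * C * D\<^sup>2"
  have "D > 0" by (simp add: D_def)
  then have K: "K > 0" using C by (simp add: K_def add_pos_nonneg)
  define B where "B = 3 * C / c"
  have B: "B \<ge> 3" using c C by (simp add: B_def field_simps)
  \<comment> \<open>For \<open>norm w < \<omega>\<close> the preimage to be constructed has its
    normal coordinate in the range where the cutoff is close to 1 and lies in the ball of radius
    \<open>r1\<close>; \<open>B\<close> bounds \<open>norm s\<close> against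
    \<open>norm w\<close>.\<close>
  define \<omega> where "\<omega> = min (d1 / (2 * B)) (min (r1 / (8 * B)) (c * r1\<^sup>2 / 1000))"
  have om: "\<omega> > 0" using d1 r1 B c by (simp add: \<omega>_def)
  \<comment> \<open>As \<open>norm a \<le> 2 * t\<close>, the first two entries give the smallness
    conditions of \<open>cayley_far\<close>, and the third puts \<open>2 * norm a / e\<close> below
    \<omega>.\<close>
  define T where "T = min (\<kappa> / 4) (min (e * \<kappa>\<^sup>2 / (32 * K)) (e * \<omega> / 4))"
  have T: "T > 0" using kap e K om by (simp add: T_def)
  define r where "r = min T (min 1 (min rs (min (r0 / 2) (min (r1 / 2) rl))))"
  have r: "r > 0" using T rs r0 r1 rl by (simp add: r_def)
  obtain r' where r': "r' > 0" and bdry: "\<And>q. q \<in> \<Omega> \<Longrightarrow> q \<in> ball p r' \<Longrightarrow>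
        \<exists>t. 0 < t \<and> t < r \<and> q - t *\<^sub>R \<nu> \<in> ball p r \<and> \<rho> (q - t *\<^sub>R \<nu>) = 0"
    using boundary_below[OF r] by blast
  have "\<exists>f :: complex^'n \<Rightarrow> complex^'n.
    holomorphic_map_on f \<Omega> \<and> inj_on f \<Omega> \<and> f q = 0 \<and>
      (\<forall>v\<in>\<Omega>. (norm (f v))\<^sup>2 \<le> 1 + e) \<and> ball 0 (1 - e) \<subseteq> f ` \<Omega>" if q: "q \<in> \<Omega>" "q \<in> ball p r'" for q
  proof -
    obtain t where t: "0 < t" "t < r" and x_r: "q - t *\<^sub>R \<nu> \<in> ball p r" and rx: "\<rho> (q - t *\<^sub>R \<nu>) = 0"
      using bdry[OF q] by blast
    define x where "x = q - t *\<^sub>R \<nu>"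
    have xr: "dist p x < r" and rx: "\<rho> x = 0" using x_r rx by (auto simp: x_def)
    have qx: "q = x + t *\<^sub>R \<nu>" by (simp add: x_def)
    have xb: "x \<in> ball p rs" "x \<in> ball p r0" "x \<in> ball p r1" "x \<in> ball p rl"
      and xd: "dist p x < 1" "dist p x < r0 / 2" "dist p x < r1 / 2"
      using xr r0 r1 by (auto simp: r_def)
    have tT: "t < \<kappa> / 4" "t < e * \<kappa>\<^sup>2 / (32 * K)" "t < e * \<omega> / 4"
      using t by (auto simp: r_def T_def)
    have xnot: "x \<notin> \<Omega>" using T0[OF xb(2) rx xb(2)] rx by simp
    note supp = rs(2)[OF xb(1) rx]
    have ell2: "norm (ell x u) \<le> 2 * norm u" for u
      using ellx[OF xb(4), of u] ell_le[of u] norm_triangle_ineq[of "ell x u - ell p u" "ell p u"] norm_ge_zero[of u]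
      unfolding diff_add_cancel by linarith
    define n where "n = ell x \<nu>"
    have n1: "norm (n - 1) \<le> 1 / 16" using ellx[OF xb(4), of \<nu>] by (simp add: n_def ell_nu norm_nu)
    have "\<bar>Re n - 1\<bar> \<le> 1 / 16" and nI: "\<bar>Im n\<bar> \<le> 1 / 16"
      using abs_Re_le_cmod[of "n - 1"] abs_Im_le_cmod[of "n - 1"] n1 by auto
    moreover have "norm n \<le> norm (n - 1) + 1" using norm_triangle_ineq[of "n - 1" 1] by simp
    ultimately have n: "Re n \<ge> 15 / 16" "norm n \<le> 2" "norm n \<ge> 15 / 16"
      using n1 complex_Re_le_cmod[of n] by linarith+
    define a where "a = ell x (t *\<^sub>R \<nu>)"
    have a_eq: "a = of_real t * n" by (simp add: a_def scaleR_eq_complex_scale ell_scale n_def)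
    have a: "0 < Re a" "\<bar>Im a\<bar> \<le> norm a / 8" "norm a \<le> 2 * t"
    proof -
      show "0 < Re a" using n t by (simp add: a_eq)
      have "t * \<bar>Im n\<bar> \<le> t * (norm n / 8)" using n nI t by (intro mult_left_mono) auto
      then show "\<bar>Im a\<bar> \<le> norm a / 8" using t by (simp add: a_eq norm_mult abs_mult)
      have "t * norm n \<le> t * 2" using n t by (intro mult_left_mono) auto
      then show "norm a \<le> 2 * t" using t by (simp add: a_eq norm_mult)
    qed
    have pos: "Re (ell x (v - x)) > 0" if "v \<in> \<Omega>" for v
    proof -
      have "v \<noteq> x" using that xnot by auto
      then have "0 < c * (norm (v - x))\<^sup>2" using c by simp
      then show ?thesis using supp[OF that] by linarith
    qed
    have into: "W \<xi> x v + cnj a \<noteq> 0 \<and> (norm (W \<xi> x v - a))\<^sup>2 + 4 * Re a * lev (P (v - x))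
        \<le> (1 + e) * (norm (W \<xi> x v + cnj a))\<^sup>2" if v: "v \<in> \<Omega>" for v
    proof -
      define u where "u = v - x"
      define z where "z = P u"
      define s where "s = ell x u"
      define w where "w = W \<xi> x v"
      define m where "m = (norm z)\<^sup>2"
      have w: "w = s - h z * \<xi> s" by (simp add: w_def W_def s_def z_def u_def)
      have z0: "ell p z = 0" by (simp add: z_def)
      have m0: "0 \<le> m" by (simp add: m_def)
      have hz: "norm (h z) \<le> C * m" and lz: "c * m \<le> lev z" "lev z \<le> C * m"
        using h_le[OF z0] lev_ge[OF z0] lev_le[OF z0] by (auto simp: m_def)
      have mu: "m \<le> (norm u)\<^sup>2" unfolding m_def z_def by (intro power_mono P_le) auto
      have su: "c * (norm u)\<^sup>2 \<le> Re s" using supp[OF v] by (simp add: u_def s_def)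
      have cm: "c * m \<le> Re s"
        using mult_left_mono[OF mu, of c] c su by linarith
      have spos: "Re s > 0" using pos[OF v] by (simp add: s_def u_def)
      have sn: "Re s \<le> norm s" by (rule complex_Re_le_cmod)
      show ?thesis
      \<comment> \<open>For small normal coordinate the fine expansion feeds
        \<open>cayley_near\<close>. Otherwise \<open>w\<close> stays away from 0 and the crude
        bounds of \<open>cayley_far\<close> suffice.\<close>
      proof (cases "norm s < d")
        case True
        have "(norm u)\<^sup>2 < (r1 / 2)\<^sup>2"
        proof -
          have "c * (norm u)\<^sup>2 < c * (r1 / 2)\<^sup>2" using su sn True by (simp add: d_def)
          then show ?thesis using c by simp
        qed
        then have "norm u < r1 / 2" using r1 by (intro power2_less_imp_less[of "norm u"]) auto
        then have "v \<in> ball p r1"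
          using xd(3) dist_triangle[of p v x] by (simp add: u_def dist_norm norm_minus_commute)
        from T1[OF xb(3) rx this] v
        have "lev z - \<epsilon> * (m + norm s) \<le> Re s - Re (h z)"
          by (simp add: s_def z_def u_def m_def abs_le_iff)
        from cutoff_near_bound[OF c C m0 hz lz(1) this d1(2)[OF spos] less_imp_le[OF eps0] eps2] True
        have "lev z - Re w \<le> e / 8 * norm w" unfolding w[symmetric] eps1 by (simp add: d_def)
        from cayley_near[OF a(2,1) _ _ lev_nonneg[OF z0] this] e
        have 1: "w + cnj a \<noteq> 0" "(norm (w - a))\<^sup>2 + 4 * Re a * lev z \<le> (1 + 4 * (e / 8)) * (norm (w + cnj a))\<^sup>2"
          by auto
        have "(1 + 4 * (e / 8)) * (norm (w + cnj a))\<^sup>2 \<le> (1 + e) * (norm (w + cnj a))\<^sup>2"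
          using e by (intro mult_right_mono) auto
        from order_trans[OF 1(2) this] 1(1) show ?thesis by (simp add: w_def z_def u_def)
      next
        case False
        have "\<kappa> \<le> norm w"
        proof (cases "norm u < r0 / 2")
          case True
          then have "v \<in> ball p r0"
            using xd(2) dist_triangle[of p v x] by (simp add: u_def dist_norm norm_minus_commute)
          from T0[OF xb(2) rx this] v
          have t0: "lev z - k * (m + norm s) \<le> Re s - Re (h z)"
            by (simp add: s_def z_def u_def m_def abs_le_iff)
          have "norm s \<le> (1 + 8 * C / c) * norm w" unfolding w
            using rng[OF spos] k by (intro cutoff_far_bound[OF c C m0 hz lz(1) cm t0]) auto
          then have "d \<le> (1 + 8 * C / c) * norm w" using False by simp
          then have "d / (1 + 8 * C / c) \<le> norm w" using Cc by (simp add: pos_divide_le_eq mult.commute)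
          then show ?thesis by (simp add: \<kappa>_def)
        next
          case False
          then have "(r0 / 2)\<^sup>2 \<le> (norm u)\<^sup>2" using r0 by (intro power_mono) auto
          then have "r2 \<le> c * (norm u)\<^sup>2" unfolding r2_def using c by (intro mult_left_mono) auto
          then have s2: "r2 \<le> norm s" using su sn by linarith
          have "norm (h z * \<xi> s) \<le> (C * m) * (c / (2 * C))"
            unfolding norm_mult using hz small[OF spos s2] C m0 by (intro mult_mono) auto
          also have "\<dots> = c * m / 2" using C by simp
          finally have "norm (h z * \<xi> s) \<le> norm s / 2" using cm sn by linarith
          moreover have "norm s - norm (h z * \<xi> s) \<le> norm w" unfolding w by (rule norm_triangle_ineq2)
          ultimately show ?thesis using s2 by (simp add: \<kappa>_def)
        qed
        moreover have "lev z - Re w \<le> K"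
        proof -
          have "norm u \<le> D" using D0[OF v] xd(1) dist_triangle[of v x p]
            by (simp add: D_def u_def dist_norm norm_minus_commute)
          then have uD: "(norm u)\<^sup>2 \<le> D\<^sup>2" and sD: "norm s \<le> 2 * D"
            using ell2[of u] by (auto intro!: power_mono simp: s_def)
          have Cm: "C * m \<le> C * D\<^sup>2" using C uD mu by (intro mult_left_mono) auto
          have "norm (\<xi> s) \<le> 2" using rng[OF spos] cmod_le[of "\<xi> s"] k C c
            by (smt (verit) mult_left_le_one_le mult_le_cancel_right1)
          then have "norm (h z * \<xi> s) \<le> (C * m) * 2"
            unfolding norm_mult using hz C m0 by (intro mult_mono) auto
          moreover have "norm w \<le> norm s + norm (h z * \<xi> s)" unfolding w by (rule norm_triangle_ineq4)
          moreover have "- Re w \<le> norm w" using abs_Re_le_cmod[of w] by simp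
          ultimately show ?thesis using Cm sD lz(2) by (simp add: K_def)
        qed
        moreover have "16 * norm a * K \<le> e * \<kappa>\<^sup>2"
        proof -
          have "norm a * (16 * K) \<le> (2 * t) * (16 * K)" using a(3) K by (intro mult_right_mono) auto
          moreover have "t * (32 * K) < e * \<kappa>\<^sup>2" using tT(2) K by (simp add: pos_less_divide_eq)
          ultimately show ?thesis by (simp add: algebra_simps)
        qed
        ultimately show ?thesis
          using cayley_far[OF kap _ _ a(1), of w "lev z" K e] a(3) tT(1) K e
          by (auto simp: w_def z_def u_def)
      qed
    qed
    have onto: "\<exists>v\<in>\<Omega>. P (v - x) = z \<and> W \<xi> x v = w"
      if z0: "ell p z = 0" and wn: "norm w \<le> 2 * norm a / e" and wpos: "0 < Re w - lev z"
        and wl: "e / 4 * norm w \<le> Re w - lev z" for z w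
    proof -
      define m where "m = (norm z)\<^sup>2"
      have m0: "0 \<le> m" by (simp add: m_def)
      have hz: "norm (h z) \<le> C * m" and lz: "c * m \<le> lev z" and lh: "c * m \<le> lev z + Re (h z)"
        using h_le[OF z0] lev_ge[OF z0] lev_h_ge[OF z0] by (auto simp: m_def)
      have "2 * norm a / e \<le> 2 * (2 * t) / e" using a(3) e by (intro divide_right_mono) auto
      also have "\<dots> < \<omega>" using tT(3) e by (simp add: field_simps)
      finally have w_om: "norm w < \<omega>" using wn by linarith
      have mw: "c * m \<le> norm w" using lz wpos complex_Re_le_cmod[of w] by linarith
      have wn0: "norm w > 0" using wpos lev_nonneg[OF z0] by auto
      have Cm: "C * m \<le> B / 3 * norm w"
      proof -
        have "C * m = C / c * (c * m)" using c by simp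
        also have "\<dots> \<le> C / c * norm w" using mw c C by (intro mult_left_mono) auto
        finally show ?thesis by (simp add: B_def)
      qed
      have eC: "\<epsilon> * (C * m) \<le> c * m / 8"
        using mult_right_mono[OF eps2 m0] by (simp add: algebra_simps)
      \<comment> \<open>\<open>R\<close> bounds \<open>norm (h z)\<close> times the deviation of the
        cutoff from 1. It is at most \<open>c * m / 8\<close>, so the ball about
        \<open>w + h z\<close> stays in the right half plane.\<close>
      define R where "R = \<epsilon> * (C * m)"
      have R0: "R \<ge> 0" using eps0 C m0 by (simp add: R_def)
      have c1: "c * m \<le> C * m" using c C m0 by (intro mult_right_mono) auto
      have "0 \<le> c * m" using c m0 by simp
      then have RC: "R \<le> C * m" using eC c1 unfolding R_def by linarith
      have sball: "Re s \<ge> Re w + Re (h z) - R" "Re s > 0" "norm s \<le> B * norm w" "norm s < d1"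
        if s: "s \<in> cball (w + h z) R" for s
      proof -
        have sd: "norm (s - (w + h z)) \<le> R" using s by (simp add: dist_norm norm_minus_commute)
        then show 1: "Re s \<ge> Re w + Re (h z) - R"
          using abs_Re_le_cmod[of "s - (w + h z)"] by (simp add: abs_le_iff)
        have "c * m \<ge> 0" using c m0 by simp
        then show "Re s > 0" using 1 lh wpos eC by (simp add: R_def)
        have "norm s \<le> norm (s - (w + h z)) + (norm w + norm (h z))"
          using norm_triangle_ineq[of "s - (w + h z)" "w + h z"] norm_triangle_ineq[of w "h z"] by simp
        also have "\<dots> \<le> norm w + 2 * (B / 3 * norm w)" using sd RC hz Cm by linarith
        also have "\<dots> = (1 + 2 / 3 * B) * norm w" by (simp add: algebra_simps)
        also have "\<dots> \<le> B * norm w" using B by (intro mult_right_mono) auto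
        finally show 2: "norm s \<le> B * norm w" .
        have "norm w * (2 * B) < d1" using w_om B by (simp add: \<omega>_def pos_less_divide_eq)
        moreover have "0 \<le> B * norm w" using B by simp
        ultimately show "norm s < d1" using 2 by (simp add: mult.commute[of "norm w"])
      qed
      have "continuous_on (cball (w + h z) R) \<xi>"
        using der sball(2) by (intro continuous_at_imp_continuous_on ballI DERIV_isCont) blast
      moreover have "norm (h z) * norm (\<xi> s - 1) \<le> R" if "s \<in> cball (w + h z) R" for s
      proof -
        have "norm (h z) * norm (\<xi> s - 1) \<le> (C * m) * \<epsilon>"
          using hz d1(2)[OF sball(2,4)[OF that]] C m0 by (intro mult_mono) auto
        then show ?thesis by (simp add: R_def mult.commute)
      qed
      ultimately obtain s where s: "s \<in> cball (w + h z) R" and sw: "s - h z * \<xi> s = w"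
        using cutoff_fixed_point[OF R0] by blast
      \<comment> \<open>\<open>\<tau>\<close> solves \<open>ell x (\<tau> *s \<nu> + z) = s\<close>.
        Adding a multiple of \<nu> does not change the projection \<open>P\<close>, so the resulting
        point has the prescribed coordinates.\<close>
      define \<tau> where "\<tau> = (s - ell x z) / n"
      define u where "u = \<tau> *s \<nu> + z"
      define v where "v = x + u"
      have Pu: "P (v - x) = z" unfolding v_def u_def using P_of[OF z0] by simp
      have n0: "n \<noteq> 0" using n by auto
      have eu: "ell x (v - x) = s" using n0 by (simp add: v_def u_def ell_add ell_scale \<tau>_def n_def)
      have Wv: "W \<xi> x v = w" by (simp add: W_def Pu eu sw)
      have "norm u < r1 / 2"
      proof -
        have "norm \<tau> = norm (s - ell x z) / norm n" by (simp add: \<tau>_def norm_divide)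
        also have "\<dots> \<le> norm (s - ell x z) / (1 / 2)" using n by (intro divide_left_mono) auto
        also have "\<dots> \<le> 2 * (norm s + 2 * norm z)"
          using norm_triangle_ineq4[of s "ell x z"] ell2[of z] by simp
        finally have "norm u \<le> 2 * norm s + 5 * norm z"
          using norm_triangle_ineq[of "\<tau> *s \<nu>" z] by (simp add: u_def norm_vector_scalar_mult norm_nu)
        moreover have "norm w * (8 * B) < r1" using w_om B by (simp add: \<omega>_def pos_less_divide_eq)
        then have "2 * norm s < r1 / 4" using sball(3)[OF s] by (simp add: mult.commute[of "norm w"])
        moreover have "norm z < r1 / 25"
        proof (rule power2_less_imp_less)
          have "c * m < c * (r1\<^sup>2 / 1000)" using mw w_om by (simp add: \<omega>_def)
          then have "m < r1\<^sup>2 / 1000" using c by simp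
          also have "\<dots> \<le> (r1 / 25)\<^sup>2" by (simp add: power_divide)
          finally show "(norm z)\<^sup>2 < (r1 / 25)\<^sup>2" by (simp add: m_def)
        qed (use r1 in auto)
        ultimately show ?thesis using r1 by linarith
      qed
      then have vb: "v \<in> ball p r1"
        using xd(3) dist_triangle[of p v x] by (simp add: v_def dist_norm norm_minus_commute)
      \<comment> \<open>The margin \<open>e / 4 * norm w\<close> beats the Taylor and fixed-point
        errors, which together are at most \<open>e / 32 * norm w\<close>.\<close>
      have "\<rho> v \<le> - Re s + lev z + Re (h z) + \<epsilon> * (m + norm s)"
        using T1[OF xb(3) rx vb] by (simp add: Pu eu m_def abs_le_iff)
      also have "\<dots> \<le> - (e / 4 * norm w) + (\<epsilon> * (C * m) + \<epsilon> * (m + norm s))"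
        using sball(1)[OF s] wl by (simp add: R_def)
      also have "\<epsilon> * (C * m) + \<epsilon> * (m + norm s) = \<epsilon> * (C * m + m + norm s)"
        by (simp add: algebra_simps)
      also have "\<dots> \<le> \<epsilon> * (B / 3 * norm w + B / 3 * norm w + B * norm w)"
      proof -
        have "1 * m \<le> C * m" using C m0 by (intro mult_right_mono) auto
        then show ?thesis using Cm sball(3)[OF s] eps0 by (intro mult_left_mono) auto
      qed
      also have "\<dots> = (20 * C / c * \<epsilon>) / 4 * norm w" by (simp add: B_def)
      also have "\<dots> = e / 32 * norm w" by (simp only: eps1)
      also have "- (e / 4 * norm w) + e / 32 * norm w < 0" using e wn0 by simp
      finally have "v \<in> \<Omega>" using T1[OF xb(3) rx vb] by simp
      then show ?thesis using Pu Wv by blast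
    qed
    have "0 < C * k" using k C by simp
    then have "2 * C * k \<le> c" using k(2) by simp
    from almost_ball_map[OF e xnot supp der bd this a(1,2)[unfolded a_def] into[unfolded a_def] onto[unfolded a_def]]
    show ?thesis unfolding qx .
  qed
  then show ?thesis using r' by blast
qed

end

section \<open>Normal form at a spherically extreme point\<close>

lemma inner_ii_skew: "(\<i> *s u) \<bullet> v = - (u \<bullet> (\<i> *s (v :: complex^'n)))"
  by (simp add: inner_vec_def inner_complex_def flip: sum_negf)

text \<open>Normalised data: \<rho> is scaled so that its gradient at \<open>p\<close> is
  \<open>- \<nu>\<close>, \<open>B\<close> is half its Hessian there, and \<open>in_ball\<close> is
  the expanded form of membership in the ball of radius \<open>R\<close> about
  \<open>p + R *\<^sub>R \<nu>\<close>.\<close>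

locale extreme_boundary =
  fixes \<Omega> U :: "(complex^'n) set" and p \<nu> :: "complex^'n" and R :: real and \<rho> :: "complex^'n \<Rightarrow> real"
    and D B :: "complex^'n \<Rightarrow> complex^'n \<Rightarrow> real"
  assumes norm_nu: "norm \<nu> = 1" and R: "R > 0"
    and in_ball: "\<And>v. v \<in> \<Omega> \<Longrightarrow> (norm (v - p))\<^sup>2 < 2 * R * ((v - p) \<bullet> \<nu>)"
    and D_linear: "\<And>x. linear (D x)" and D_p: "\<And>u. D p u = - (u \<bullet> \<nu>)"
    and D_cont: "\<And>e. e > 0 \<Longrightarrow> \<exists>r>0. \<forall>x\<in>ball p r. \<forall>u. \<bar>D x u - D p u\<bar> \<le> e * norm u"
    and B_bilinear: "bounded_bilinear B" and B_sym: "\<And>u v. B u v = B v u"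
    and taylor2: "\<And>e. e > 0 \<Longrightarrow> \<exists>r>0. ball p r \<subseteq> U \<and> (\<forall>x\<in>ball p r. \<forall>y\<in>ball p r.
        \<bar>\<rho> y - \<rho> x - D x (y - x) - B (y - x) (y - x)\<bar> \<le> e * (norm (y - x))\<^sup>2)"
    and inside: "\<And>v. v \<in> U \<Longrightarrow> v \<in> \<Omega> \<longleftrightarrow> \<rho> v < 0"
    and rho_p: "\<rho> p = 0" and rho_cont: "continuous_on U \<rho>"
begin

sublocale B: bounded_bilinear B by (rule B_bilinear)

lemma B_bound: obtains K where "K > 0" "\<And>u v. \<bar>B u v\<bar> \<le> K * norm u * norm v"
  using B.pos_bounded by (auto simp: mult_ac)

lemma nu_nu: "\<nu> \<bullet> \<nu> = 1"
  using norm_nu by (simp add: norm_eq_1)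

lemma ii_nu_nu: "(\<i> *s \<nu>) \<bullet> \<nu> = 0" "\<nu> \<bullet> (\<i> *s \<nu>) = 0"
  using inner_ii_skew[of \<nu> \<nu>] by (simp_all add: inner_commute)

text \<open>Comparison with the sphere: were \<open>B\<close> smaller in a tangential direction, a
  parabola tangent to the sphere would enter the domain, although by Pythagoras it stays outside the
  ball.\<close>

lemma B_tangent:
  assumes "u \<bullet> \<nu> = 0"
  shows "(norm u)\<^sup>2 / (2 * R) \<le> B u u"
proof (rule ccontr)
  assume neg: "\<not> ?thesis"
  \<comment> \<open>With this \<open>b\<close> the curve
    \<open>p + t *\<^sub>R u + (t\<^sup>2 * b) *\<^sub>R \<nu>\<close> agrees with the sphere to
    second order.\<close>
  define b where "b = (norm u)\<^sup>2 / (2 * R)"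
  have u: "u \<noteq> 0" using neg B.zero_left by auto
  define e where "e = (b - B u u) / (2 * ((norm u)\<^sup>2 + 1))"
  have e: "e > 0" using neg by (simp add: e_def b_def add_nonneg_pos)
  obtain r where r: "r > 0" "ball p r \<subseteq> U" and T: "\<And>y. y \<in> ball p r \<Longrightarrow>
      \<bar>\<rho> y - \<rho> p - D p (y - p) - B (y - p) (y - p)\<bar> \<le> e * (norm (y - p))\<^sup>2"
    using taylor2[OF e] by (metis centre_in_ball)
  define w where "w t = u + (t * b) *\<^sub>R \<nu>" for t :: real
  \<comment> \<open>\<open>t\<^sup>2 * g t\<close> is the Taylor upper bound for \<rho> along the
    curve. The choice of \<open>e\<close> makes \<open>g 0\<close> negative, and continuity extends
    this to small \<open>t\<close>.\<close>
  define g where "g t = - b + B (w t) (w t) + e * (norm (w t))\<^sup>2" for t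
  have "isCont g 0" unfolding g_def w_def
    by (intro continuous_intros bounded_bilinear.continuous[OF B_bilinear])
  moreover have "e * (norm u)\<^sup>2 < b - B u u"
  proof -
    have "e * (norm u)\<^sup>2 \<le> e * ((norm u)\<^sup>2 + 1)" using e by simp
    also have "\<dots> = (b - B u u) / 2"
    proof -
      have "(norm u)\<^sup>2 + 1 \<noteq> 0" using zero_le_power2[of "norm u"] by linarith
      then show ?thesis unfolding e_def times_divide_eq_left by (rule mult_divide_mult_cancel_right)
    qed
    also have "\<dots> < b - B u u" using neg by (simp add: b_def)
    finally show ?thesis .
  qed
  then have "g 0 < 0" by (simp add: g_def w_def)
  ultimately have "\<forall>\<^sub>F t in at 0. g t < 0"
    unfolding isCont_def by (rule order_tendstoD(2))
  then obtain d where d: "d > 0" "\<And>t. t \<noteq> 0 \<Longrightarrow> \<bar>t\<bar> < d \<Longrightarrow> g t < 0"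
    unfolding eventually_at by (auto simp: dist_real_def)
  define t where "t = min (d / 2) (min 1 (r / (2 * (norm u + \<bar>b\<bar>))))"
  have nb: "norm u + \<bar>b\<bar> > 0" using u by (simp add: add_pos_nonneg)
  have t: "t > 0" "t < d" "t \<le> 1" "t * (norm u + \<bar>b\<bar>) < r"
  proof -
    show "t > 0" "t < d" "t \<le> 1" using d r nb by (auto simp: t_def)
    have "t \<le> r / (2 * (norm u + \<bar>b\<bar>))" by (simp add: t_def)
    then have "t * (2 * (norm u + \<bar>b\<bar>)) \<le> r" using nb by (simp add: pos_le_divide_eq)
    then show "t * (norm u + \<bar>b\<bar>) < r" using r(1) by (simp add: algebra_simps)
  qed
  define y where "y = p + t *\<^sub>R w t"
  have "norm (w t) \<le> norm u + norm ((t * b) *\<^sub>R \<nu>)" unfolding w_def by (rule norm_triangle_ineq)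
  also have "\<dots> \<le> norm u + \<bar>b\<bar>" using t by (simp add: norm_nu abs_mult mult_left_le_one_le)
  finally have "t * norm (w t) \<le> t * (norm u + \<bar>b\<bar>)" using t by (intro mult_left_mono) auto
  then have "t * norm (w t) < r" using t(4) by linarith
  then have "y \<in> ball p r" using t(1) by (simp add: y_def dist_norm)
  from T[OF this] have "\<rho> y \<le> D p (t *\<^sub>R w t) + B (t *\<^sub>R w t) (t *\<^sub>R w t) + e * (norm (t *\<^sub>R w t))\<^sup>2"
    by (simp add: y_def rho_p abs_le_iff)
  also have "\<dots> = t\<^sup>2 * g t"
    using assms nu_nu by (simp add: D_p w_def[of t] g_def inner_add_left power_mult_distrib B.scaleR_left B.scaleR_right)
      (simp add: power2_eq_square algebra_simps)
  also have "\<dots> < 0" using d(2)[of t] t by (simp add: mult_pos_neg)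
  finally have "y \<in> \<Omega>" using inside r \<open>y \<in> ball p r\<close> by blast
  from in_ball[OF this] have "t\<^sup>2 * (norm (w t))\<^sup>2 < t\<^sup>2 * (norm u)\<^sup>2"
    using assms nu_nu R by (simp add: y_def w_def[of t] inner_add_left power_mult_distrib b_def)
      (simp add: power2_eq_square algebra_simps)
  moreover have "(norm (w t))\<^sup>2 = (norm u)\<^sup>2 + (t * b)\<^sup>2"
    unfolding power2_norm_eq_inner w_def
    using assms nu_nu by (simp add: inner_add_left inner_add_right inner_commute) (simp add: power2_eq_square)
  ultimately show False using t by simp
qed

section \<open>Complex normal coordinate, tangential projection and Levi form\<close>

definition ell :: "complex^'n \<Rightarrow> complex^'n \<Rightarrow> complex" where
  "ell x = complexify (\<lambda>u. - D x u)"

definition P :: "complex^'n \<Rightarrow> complex^'n" where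
  "P u = u - ell p u *s \<nu>"

lemma ell_clinear: "clinear_form (ell x)"
  unfolding ell_def by (intro clinear_form_complexify linear_compose_neg D_linear)

lemma ell_add: "ell x (u + v) = ell x u + ell x v"
  and ell_diff: "ell x (u - v) = ell x u - ell x v"
  and ell_scale: "ell x (k *s u) = k * ell x u"
  using ell_clinear[of x]
  by (auto simp: clinear_form_def linear_conv_bounded_linear[symmetric] linear_add linear_diff)

lemma Re_ell: "Re (ell x u) = - D x u"
  by (simp add: ell_def complexify_def)

lemma ell_p: "ell p u = Complex (u \<bullet> \<nu>) (- ((\<i> *s u) \<bullet> \<nu>))"
  by (simp add: ell_def complexify_def D_p)

lemma ell_nu: "ell p \<nu> = 1"
  by (simp add: ell_p nu_nu ii_nu_nu complex_eq_iff)

lemma ell_zeroD: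
  assumes "ell p z = 0"
  shows "z \<bullet> \<nu> = 0" "(\<i> *s z) \<bullet> \<nu> = 0" "P z = z"
  using assms by (auto simp: ell_p P_def complex_eq_iff)

lemma ell_P: "ell p (P u) = 0"
  by (simp add: P_def ell_diff ell_scale ell_nu)

lemma P_linear: "linear P"
  by (rule linearI) (simp_all add: P_def ell_add scaleR_eq_complex_scale ell_scale vec_eq_iff algebra_simps)

lemma P_scale: "P (k *s u) = k *s P u"
  by (simp add: P_def ell_scale vec_eq_iff algebra_simps)

text \<open>\<open>P u\<close> is orthogonal to \<nu> and to \<open>\<i> *s \<nu>\<close>, hence to
  the complex line they span: \<open>P\<close> is the orthogonal projection onto the complex tangent
  space.\<close>

lemma norm_P: "(norm u)\<^sup>2 = (norm (P u))\<^sup>2 + (norm (ell p u))\<^sup>2"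
proof -
  let ?k = "ell p u"
  have 1: "\<nu> \<bullet> P u = 0" using ell_zeroD(1)[OF ell_P] by (simp add: inner_commute)
  have 2: "(\<i> *s \<nu>) \<bullet> P u = 0" using ell_zeroD(2)[OF ell_P, of u] by (simp add: inner_ii_skew inner_commute)
  have "(?k *s \<nu>) \<bullet> P u = 0"
    unfolding vector_complex_decomp[of ?k \<nu>] by (simp add: inner_add_left 1 2)
  then have "(norm (P u + ?k *s \<nu>))\<^sup>2 = (norm (P u))\<^sup>2 + (norm (?k *s \<nu>))\<^sup>2"
    by (intro norm_add_Pythagorean) (simp add: orthogonal_def inner_commute)
  then show ?thesis by (simp add: P_def norm_vector_scalar_mult norm_nu)
qed

lemma P_le: "norm (P u) \<le> norm u" and ell_le: "norm (ell p u) \<le> norm u"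
  using norm_P[of u] by (auto intro: power2_le_imp_le)

lemma norm_ii: "norm (\<i> *s (u :: complex^'n)) = norm u"
  by (simp add: norm_vector_scalar_mult)

lemma ell_cont: 
  assumes "e > 0" shows "\<exists>r>0. \<forall>x\<in>ball p r. \<forall>u. norm (ell x u - ell p u) \<le> e * norm u"
proof -
  obtain r where r: "r > 0" "\<And>x u. x \<in> ball p r \<Longrightarrow> \<bar>D x u - D p u\<bar> \<le> e / 2 * norm u"
    using D_cont[of "e / 2"] assms by auto
  have "norm (ell x u - ell p u) \<le> e * norm u" if "x \<in> ball p r" for x u
  proof -
    have "norm (ell x u - ell p u) \<le> \<bar>Re (ell x u - ell p u)\<bar> + \<bar>Im (ell x u - ell p u)\<bar>"
      by (rule cmod_le)
    also have "\<dots> = \<bar>D x u - D p u\<bar> + \<bar>D x (\<i> *s u) - D p (\<i> *s u)\<bar>"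
      by (simp add: ell_def complexify_def abs_minus_commute)
    also have "\<dots> \<le> e / 2 * norm u + e / 2 * norm (\<i> *s u)"
      using r(2)[OF that] by (intro add_mono) auto
    finally show ?thesis by (simp add: norm_ii)
  qed
  with r show ?thesis by blast
qed

text \<open>Averaging over \<open>z\<close> and \<open>\<i> *s z\<close> extracts the Hermitian part
  of \<open>B\<close>, which is unchanged when \<open>z\<close> is multiplied by a scalar of modulus
  1.\<close>

definition lev :: "complex^'n \<Rightarrow> real" where
  "lev z = (B z z + B (\<i> *s z) (\<i> *s z)) / 2"

text \<open>The polarisation of \<open>h\<close>: the complex-bilinear part of the real form \<open>B\<close>.\<close>

definition hb :: "complex^'n \<Rightarrow> complex^'n \<Rightarrow> complex" where
  "hb u v = complexify (\<lambda>y. (B y v - B (\<i> *s y) (\<i> *s v)) / 2) u"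

lemma hb_sym: "hb u v = hb v u"
  by (simp add: hb_def complexify_def complex_eq_iff B_sym[of v] B_sym[of "\<i> *s v"] ii_scale_scale B.minus_left B.minus_right)

lemma ii_linear: "linear ((*s) \<i> :: complex^'n \<Rightarrow> complex^'n)"
  by (rule linearI) (simp_all add: vec_eq_iff algebra_simps)

lemma B_ii_linear: "linear (\<lambda>y. B (\<i> *s y) w)"
  using linear_compose[OF ii_linear bounded_linear.linear[OF B.bounded_linear_left]] by (simp add: o_def)

lemma hb_clinear: "clinear_form (\<lambda>u. hb u v)"
proof -
  have "linear (\<lambda>y. (B y v - B (\<i> *s y) (\<i> *s v)) / 2)"
    using linear_compose_scale_right[OF linear_compose_sub[OF bounded_linear.linear[OF B.bounded_linear_left[of v]] B_ii_linear[of "\<i> *s v"]], of "1/2"]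
    by (simp add: field_simps)
  then show ?thesis unfolding hb_def by (rule clinear_form_complexify)
qed

lemma hb_scale: "hb (k *s u) v = k * hb u v" "hb v (k *s u) = k * hb v u"
  using hb_clinear[of v] by (auto simp: clinear_form_def hb_sym[of v])

lemma hb_bilinear: "bounded_bilinear hb"
proof -
  have l: "linear (\<lambda>u. hb u v)" for v
    using hb_clinear[of v] by (simp add: clinear_form_def linear_conv_bounded_linear)
  moreover have "linear (\<lambda>v. hb u v)" for u
    using l[of u] by (simp add: hb_sym[of _ u])
  ultimately show ?thesis by (simp add: bilinear_conv_bounded_bilinear[symmetric] bilinear_def)
qed

lemma lev_plus_hb: "lev z + Re (hb z z) = B z z"
  by (simp add: lev_def hb_def complexify_def field_simps)

lemma lev_scale: "lev (k *s z) = (norm k)\<^sup>2 * lev z"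
proof -
  have 1: "\<i> *s (k *s z) = Re k *\<^sub>R (\<i> *s z) - Im k *\<^sub>R z"
    by (simp add: vec_eq_iff complex_eq_iff)
  have 2: "B (\<i> *s z) z = B z (\<i> *s z)" by (rule B_sym)
  show ?thesis
    unfolding lev_def 1 unfolding vector_complex_decomp[of k z] cmod_power2
    by (simp add: B.add_left B.add_right B.diff_left B.diff_right B.scaleR_left B.scaleR_right 2)
      (simp add: power2_eq_square algebra_simps)
qed

lemma hb_holo: "holo_at (\<lambda>v. hb (P (v - x)) (P (v - x))) v"
proof -
  have P: "((\<lambda>v. P (v - x)) has_derivative P) (at v)"
  proof -
    have "((\<lambda>v. v - x) has_derivative (\<lambda>v. v)) (at v)" by (auto intro!: derivative_eq_intros)
    from bounded_linear.has_derivative[OF _ this, of P] show ?thesis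
      using P_linear by (simp add: linear_conv_bounded_linear)
  qed
  let ?D = "\<lambda>w. hb (P (v - x)) (P w) + hb (P w) (P (v - x))"
  have "((\<lambda>v. hb (P (v - x)) (P (v - x))) has_derivative ?D) (at v)"
    by (rule bounded_bilinear.FDERIV[OF hb_bilinear P P])
  moreover have "?D (k *s w) = k * ?D w" for k w
    by (simp add: P_scale hb_scale algebra_simps)
  ultimately show ?thesis unfolding holo_at_def by blast
qed

text \<open>The polarised right-hand side is invariant under the imaginary unit. It is positive
  since the complex tangent space is closed under that unit, so \<open>B_tangent\<close> applies to
  both \<open>P u\<close> and \<open>\<i> *s P u\<close>.\<close>

lemma levi_isometry:
  obtains M :: "complex^'n \<Rightarrow> complex^'n" where "linear M" "\<And>k v. M (k *s v) = k *s M v" "bij M"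
    "\<And>u. (norm (M u))\<^sup>2 = lev (P u) + (norm (ell p u))\<^sup>2"
proof -
  define G where "G u v = (B (P u) (P v) + B (\<i> *s P u) (\<i> *s P v)) / 2 + (u \<bullet> \<nu>) * (v \<bullet> \<nu>)
      + ((\<i> *s u) \<bullet> \<nu>) * ((\<i> *s v) \<bullet> \<nu>)" for u v
  have Guu: "G u u = lev (P u) + (norm (ell p u))\<^sup>2" for u
    by (simp add: G_def lev_def ell_p cmod_power2) (simp add: power2_eq_square)
  have sym: "G u v = G v u" for u v
    by (simp add: G_def B_sym[of "P v"] B_sym[of "\<i> *s P v"])
  have lin: "linear (\<lambda>u. G u v)" for v
  proof (rule linearI)
    show "G (a + b) v = G a v + G b v" for a b
      by (simp add: G_def linear_add[OF P_linear] vector_add_ldistrib B.add_left inner_add_left algebra_simps add_divide_distrib)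
    have "\<i> *s (r *\<^sub>R b) = r *\<^sub>R (\<i> *s b)" for r and b :: "complex^'n" by (simp add: vec_eq_iff)
    then show "G (r *\<^sub>R b) v = r *\<^sub>R G b v" for r b
      by (simp add: G_def linear_scale[OF P_linear] B.scaleR_left algebra_simps add_divide_distrib)
  qed
  have "bilinear G"
    unfolding bilinear_def using lin sym by simp
  moreover have "G (\<i> *s u) (\<i> *s v) = G u v" for u v
    by (simp only: G_def P_scale ii_scale_scale B.minus_left B.minus_right inner_minus_left) simp
  moreover have "G u u > 0" if "u \<noteq> 0" for u
  proof -
    have z: "ell p (P u) = 0" by (rule ell_P)
    have "(norm (P u))\<^sup>2 / (2 * R) \<le> lev (P u)"
      using B_tangent[OF ell_zeroD(1)[OF z]] B_tangent[OF ell_zeroD(2)[OF z]] by (simp add: lev_def norm_ii)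
    moreover have "0 \<le> (norm (P u))\<^sup>2 / (2 * R)" using R by simp
    moreover have "P u \<noteq> 0 \<or> ell p u \<noteq> 0" using that norm_P[of u] by auto
    then have "0 < (norm (P u))\<^sup>2 / (2 * R) \<or> 0 < (norm (ell p u))\<^sup>2" using R by auto
    moreover have "0 \<le> (norm (ell p u))\<^sup>2" by simp
    ultimately show ?thesis unfolding Guu by linarith
  qed
  ultimately show ?thesis
    using hermitian_form_isometry[of G] sym Guu that by metis
qed

text \<open>Makes the error of \<open>taylor2\<close> anisotropic. The normal component of
  \<open>u\<close> is \<open>ell x u\<close> up to \<open>\<delta> * norm u\<close>, and it enters
  the error only multiplied by the small factor \<open>norm u\<close>.\<close>

lemma normal_taylor:
  assumes e: "e > 0"
  shows "\<exists>r>0. \<forall>x\<in>ball p r. \<rho> x = 0 \<longrightarrow> (\<forall>v\<in>ball p r. (v \<in> \<Omega> \<longleftrightarrow> \<rho> v < 0) \<and>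
        \<bar>\<rho> v + Re (ell x (v - x)) - lev (P (v - x)) - Re (hb (P (v - x)) (P (v - x)))\<bar>
          \<le> e * ((norm (P (v - x)))\<^sup>2 + norm (ell x (v - x))))"
proof -
  obtain K where K: "K > 0" "\<And>u v. \<bar>B u v\<bar> \<le> K * norm u * norm v" using B_bound by blast
  define \<delta> where "\<delta> = min (1 / 2) (e / (8 * K))"
  have dl: "\<delta> > 0" "\<delta> \<le> 1 / 2" "2 * K * \<delta> \<le> e / 4"
  proof -
    have "\<delta> \<le> e / (8 * K)" by (simp add: \<delta>_def)
    then show "2 * K * \<delta> \<le> e / 4" using K(1) by (simp add: field_simps)
  qed (use e K in \<open>auto simp: \<delta>_def\<close>)
  obtain r1 where r1: "r1 > 0" "ball p r1 \<subseteq> U" "\<And>x y. x \<in> ball p r1 \<Longrightarrow> y \<in> ball p r1 \<Longrightarrow>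
        \<bar>\<rho> y - \<rho> x - D x (y - x) - B (y - x) (y - x)\<bar> \<le> e / 4 * (norm (y - x))\<^sup>2"
    using taylor2[of "e / 4"] e by auto
  obtain r2 where r2: "r2 > 0" "\<And>x u. x \<in> ball p r2 \<Longrightarrow> norm (ell x u - ell p u) \<le> \<delta> * norm u"
    using ell_cont[OF dl(1)] by blast
  \<comment> \<open>The last entry forces \<open>(e + 2 * K) * norm u \<le> e\<close>, which absorbs
    the mixed terms \<open>norm (ell x u) * norm u\<close>.\<close>
  define r where "r = min r1 (min r2 (e / (2 * (e + 2 * K))))"
  have r: "r > 0" using r1 r2 e K by (simp add: r_def add_pos_pos)
  have "\<bar>\<rho> v + Re (ell x (v - x)) - lev (P (v - x)) - Re (hb (P (v - x)) (P (v - x)))\<bar>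
          \<le> e * ((norm (P (v - x)))\<^sup>2 + norm (ell x (v - x)))"
    if x: "x \<in> ball p r" and rx: "\<rho> x = 0" and v: "v \<in> ball p r" for x v
  proof -
    define u where "u = v - x"
    define y where "y = norm (ell x u)"
    have y0: "0 \<le> y" by (simp add: y_def)
    have xb: "x \<in> ball p r1" "x \<in> ball p r2" and vb: "v \<in> ball p r1" using x v by (auto simp: r_def)
    have un: "norm u \<le> e / (e + 2 * K)"
    proof -
      have "norm u < 2 * r" using x v dist_triangle[of v x p] by (simp add: u_def dist_norm norm_minus_commute)
      also have "\<dots> \<le> 2 * (e / (2 * (e + 2 * K)))" by (simp add: r_def)
      also have "\<dots> = e / (e + 2 * K)" using e K by (simp add: field_simps)
      finally show ?thesis by simp
    qed
    have ep: "norm (ell p u) \<le> y + \<delta> * norm u"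
      using norm_triangle_ineq[of "ell x u" "ell p u - ell x u"] r2(2)[OF xb(2), of u]
      by (simp add: y_def norm_minus_commute)
    define k where "k = ell p u *s \<nu>"
    have uk: "u = P u + k" by (simp add: P_def k_def)
    have nk: "norm k = norm (ell p u)" by (simp add: k_def norm_vector_scalar_mult norm_nu)
    have "B u u - B (P u) (P u) = B k u + B (P u) k"
      using B.add_left[of "P u" k u] B.add_right[of "P u" "P u" k] unfolding uk[symmetric] by simp
    also have "\<bar>\<dots>\<bar> \<le> K * norm k * norm u + K * norm (P u) * norm k"
      using K(2)[of k u] K(2)[of "P u" k] by linarith
    also have "\<dots> \<le> K * norm k * norm u + K * norm u * norm k"
      using K(1) P_le[of u] by (intro add_left_mono mult_right_mono mult_left_mono) auto
    also have "\<dots> = 2 * K * (norm (ell p u) * norm u)" by (simp add: nk)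
    also have "\<dots> \<le> 2 * K * ((y + \<delta> * norm u) * norm u)"
      using K(1) ep by (intro mult_left_mono mult_right_mono) auto
    finally have B1: "\<bar>B u u - B (P u) (P u)\<bar> \<le> 2 * K * (y * norm u) + 2 * K * \<delta> * (norm u)\<^sup>2"
      by (simp add: algebra_simps power2_eq_square)
    have "2 * K * \<delta> * (norm u)\<^sup>2 \<le> e / 4 * (norm u)\<^sup>2" using dl by (intro mult_right_mono) auto
    moreover have "\<bar>\<rho> v + Re (ell x u) - B u u\<bar> \<le> e / 4 * (norm u)\<^sup>2"
      using r1(3)[OF xb(1) vb] by (simp add: rx Re_ell u_def)
    ultimately have 1: "\<bar>\<rho> v + Re (ell x u) - B (P u) (P u)\<bar> \<le> e / 2 * (norm u)\<^sup>2 + 2 * K * (y * norm u)"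
      using B1 by linarith
    have "(norm (ell p u))\<^sup>2 \<le> norm (ell p u) * norm u"
      unfolding power2_eq_square by (intro mult_left_mono ell_le) auto
    also have "\<dots> \<le> (y + \<delta> * norm u) * norm u" using ep by (intro mult_right_mono) auto
    also have "\<dots> \<le> y * norm u + 1 / 2 * (norm u)\<^sup>2"
      using mult_right_mono[OF dl(2), of "(norm u)\<^sup>2"] by (simp add: algebra_simps power2_eq_square)
    finally have "(norm u)\<^sup>2 \<le> 2 * (norm (P u))\<^sup>2 + 2 * (y * norm u)" using norm_P[of u] by linarith
    then have "e / 2 * (norm u)\<^sup>2 \<le> e / 2 * (2 * (norm (P u))\<^sup>2 + 2 * (y * norm u))"
      using e by (intro mult_left_mono) auto
    with 1 have 2: "\<bar>\<rho> v + Re (ell x u) - B (P u) (P u)\<bar> \<le> e * (norm (P u))\<^sup>2 + y * ((e + 2 * K) * norm u)"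
      by (simp add: algebra_simps)
    have "(e + 2 * K) * norm u \<le> e" using un e K by (simp add: pos_le_divide_eq mult.commute)
    then have "y * ((e + 2 * K) * norm u) \<le> y * e" using y0 by (rule mult_left_mono)
    with 2 have "\<bar>\<rho> v + Re (ell x u) - B (P u) (P u)\<bar> \<le> e * ((norm (P u))\<^sup>2 + y)"
      by (simp add: algebra_simps)
    then show ?thesis using lev_plus_hb[of "P u"] by (simp add: u_def y_def algebra_simps)
  qed
  moreover have "v \<in> \<Omega> \<longleftrightarrow> \<rho> v < 0" if "v \<in> ball p r" for v
    using inside r1(2) that by (auto simp: r_def)
  ultimately show ?thesis using r by blast
qed

text \<open>Splitting off the component along \<nu> extends \<open>B_tangent\<close> to all vectors,
  at a cost linear in that component.\<close>

lemma B_quadratic_lower: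
  obtains K where "K > 0" "\<And>u. (norm u)\<^sup>2 / (2 * R) - K * \<bar>u \<bullet> \<nu>\<bar> * norm u \<le> B u u"
proof -
  obtain K where K: "K > 0" "\<And>u v. \<bar>B u v\<bar> \<le> K * norm u * norm v" using B_bound by blast
  define L where "L = 1 / (2 * R) + 2 * K"
  have "(norm u)\<^sup>2 / (2 * R) - L * \<bar>u \<bullet> \<nu>\<bar> * norm u \<le> B u u" for u
  proof -
    define s where "s = u \<bullet> \<nu>"
    define w where "w = u - s *\<^sub>R \<nu>"
    have w0: "w \<bullet> \<nu> = 0" by (simp add: w_def s_def inner_diff_left nu_nu)
    have u: "u = w + s *\<^sub>R \<nu>" by (simp add: w_def)
    have "(norm (w + s *\<^sub>R \<nu>))\<^sup>2 = (norm w)\<^sup>2 + (norm (s *\<^sub>R \<nu>))\<^sup>2"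
      using w0 by (intro norm_add_Pythagorean) (simp add: orthogonal_def)
    then have n: "(norm u)\<^sup>2 = (norm w)\<^sup>2 + s\<^sup>2" using u by (simp add: norm_nu)
    then have wu: "norm w \<le> norm u" by (intro power2_le_imp_le[OF _ norm_ge_zero]) simp
    have su: "\<bar>s\<bar> \<le> norm u" using Cauchy_Schwarz_ineq2[of u \<nu>] by (simp add: s_def norm_nu)
    have "B u u - B w w = B (s *\<^sub>R \<nu>) u + B w (s *\<^sub>R \<nu>)"
      using B.add_left[of w "s *\<^sub>R \<nu>" u] B.add_right[of w w "s *\<^sub>R \<nu>"] unfolding u[symmetric] by simp
    also have "\<bar>\<dots>\<bar> \<le> K * \<bar>s\<bar> * norm u + K * norm w * \<bar>s\<bar>"
      using K(2)[of "s *\<^sub>R \<nu>" u] K(2)[of w "s *\<^sub>R \<nu>"] by (simp add: norm_nu)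
    also have "\<dots> \<le> K * \<bar>s\<bar> * norm u + K * norm u * \<bar>s\<bar>"
      using K(1) wu by (intro add_left_mono mult_right_mono mult_left_mono) auto
    finally have 1: "B w w - 2 * K * \<bar>s\<bar> * norm u \<le> B u u" by (simp add: algebra_simps)
    have "s\<^sup>2 \<le> \<bar>s\<bar> * norm u"
      using mult_left_mono[OF su, of "\<bar>s\<bar>"] by (simp add: power2_eq_square)
    then have "s\<^sup>2 / (2 * R) \<le> \<bar>s\<bar> * norm u / (2 * R)" using R by (intro divide_right_mono) auto
    moreover have "(norm u)\<^sup>2 / (2 * R) = (norm w)\<^sup>2 / (2 * R) + s\<^sup>2 / (2 * R)"
      by (simp add: n add_divide_distrib)
    ultimately show ?thesis using 1 B_tangent[OF w0]
      by (simp add: L_def s_def[symmetric] algebra_simps)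
  qed
  moreover have "L > 0" using R K by (simp add: L_def add_pos_pos)
  ultimately show ?thesis using that by blast
qed

text \<open>Near \<open>p\<close>, expand at \<open>x\<close> and combine
  \<open>\<rho> v < 0\<close> with \<open>B_quadratic_lower\<close>. Far from \<open>p\<close>, the
  enclosing ball keeps \<open>(v - p) \<bullet> \<nu>\<close> away from 0, which survives a small
  change of base point and of linear form.\<close>

lemma normal_supporting:
  obtains c where "c > 0"
    "\<exists>r>0. \<forall>x\<in>ball p r. \<rho> x = 0 \<longrightarrow> (\<forall>v\<in>\<Omega>. c * (norm (v - x))\<^sup>2 \<le> Re (ell x (v - x)))"
proof -
  obtain L where L: "L > 0" "\<And>u. (norm u)\<^sup>2 / (2 * R) - L * \<bar>u \<bullet> \<nu>\<bar> * norm u \<le> B u u"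
    using B_quadratic_lower by blast
  define k where "k = 1 / (2 * R)"
  have k: "k > 0" using R by (simp add: k_def)
  define \<delta> where "\<delta> = k / (4 * L)"
  have dl: "\<delta> > 0" "L * \<delta> = k / 4" using k L by (auto simp: \<delta>_def)
  obtain r1 where r1: "r1 > 0" "ball p r1 \<subseteq> U" "\<And>x y. x \<in> ball p r1 \<Longrightarrow> y \<in> ball p r1 \<Longrightarrow>
        \<bar>\<rho> y - \<rho> x - D x (y - x) - B (y - x) (y - x)\<bar> \<le> k / 4 * (norm (y - x))\<^sup>2"
    using taylor2[of "k / 4"] k by auto
  obtain r2 where r2: "r2 > 0" "\<And>x u. x \<in> ball p r2 \<Longrightarrow> \<bar>D x u - D p u\<bar> \<le> \<delta> * norm u"
    using D_cont[OF dl(1)] by blast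
  define ra where "ra = min r1 (min r2 (1 / (4 * L)))"
  have ra: "ra > 0" using r1 r2 L by (simp add: ra_def)
  have near: "k / 4 * (norm (v - x))\<^sup>2 \<le> Re (ell x (v - x))"
    if x: "x \<in> ball p ra" and rx: "\<rho> x = 0" and v: "v \<in> \<Omega>" "v \<in> ball p ra" for x v
  proof -
    define u where "u = v - x"
    define \<sigma> where "\<sigma> = - D x u"
    have xb: "x \<in> ball p r1" "x \<in> ball p r2" and vb: "v \<in> ball p r1" using x v by (auto simp: ra_def)
    have "norm u < 2 * ra" using x v dist_triangle[of v x p] by (simp add: u_def dist_norm norm_minus_commute)
    also have "\<dots> \<le> 2 * (1 / (4 * L))" by (simp add: ra_def)
    finally have uL: "L * norm u \<le> 1 / 2" using L(1) by (simp add: field_simps)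
    have "\<rho> v < 0" using v vb r1(2) inside by blast
    then have 1: "- \<sigma> + B u u - k / 4 * (norm u)\<^sup>2 < 0"
      using r1(3)[OF xb(1) vb] unfolding rx u_def \<sigma>_def by linarith
    have "\<bar>u \<bullet> \<nu>\<bar> \<le> \<bar>\<sigma>\<bar> + \<delta> * norm u"
      using r2(2)[OF xb(2), of u] unfolding D_p \<sigma>_def by linarith
    then have "\<bar>u \<bullet> \<nu>\<bar> * (L * norm u) \<le> (\<bar>\<sigma>\<bar> + \<delta> * norm u) * (L * norm u)"
      using L(1) by (intro mult_right_mono) auto
    also have "\<dots> = \<bar>\<sigma>\<bar> * (L * norm u) + k / 4 * (norm u)\<^sup>2"
      by (simp add: algebra_simps power2_eq_square flip: dl(2))
    also have "\<dots> \<le> \<bar>\<sigma>\<bar> * (1 / 2) + k / 4 * (norm u)\<^sup>2"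
      using uL by (intro add_right_mono mult_left_mono) auto
    finally have 2: "L * \<bar>u \<bullet> \<nu>\<bar> * norm u \<le> \<bar>\<sigma>\<bar> / 2 + k / 4 * (norm u)\<^sup>2" by (simp add: mult_ac)
    have 3: "k * (norm u)\<^sup>2 - L * \<bar>u \<bullet> \<nu>\<bar> * norm u \<le> B u u"
      using L(2)[of u] by (simp add: k_def)
    have "0 \<le> k * (norm u)\<^sup>2" using k by simp
    \<comment> \<open>For negative \<sigma> the bounds contradict each other; otherwise they make
      \<sigma> at least a third of \<open>k * (norm u)\<^sup>2\<close>.\<close>
    with 1 2 3 have "k / 4 * (norm u)\<^sup>2 \<le> \<sigma>" by (simp add: abs_if split: if_splits)
    then show ?thesis by (simp add: \<sigma>_def Re_ell u_def)
  qed
  define M where "M = 2 * R + 1"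
  have M: "M > 0" using R by (simp add: M_def)
  \<comment> \<open>Outside the ball of radius \<open>ra\<close>, \<open>in_ball\<close> gives
    \<open>(v - p) \<bullet> \<nu> \<ge> 4 * g\<close>. Moving the base point and replacing
    \<open>D p\<close> by \<open>D x\<close> each cost at most \<open>g\<close>, which leaves
    \<open>2 * g\<close>.\<close>
  define g where "g = ra\<^sup>2 / (8 * R)"
  have g: "g > 0" using R ra by (simp add: g_def)
  obtain r3 where r3: "r3 > 0" "\<And>x u. x \<in> ball p r3 \<Longrightarrow> \<bar>D x u - D p u\<bar> \<le> g / M * norm u"
    using D_cont[of "g / M"] g M by auto
  define rb where "rb = min ra (min r3 (min 1 g))"
  have rb: "rb > 0" using ra r3 g by (simp add: rb_def)
  have far: "2 * g / M\<^sup>2 * (norm (v - x))\<^sup>2 \<le> Re (ell x (v - x))"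
    if x: "x \<in> ball p rb" and v: "v \<in> \<Omega>" "v \<notin> ball p ra" for x v
  proof -
    define u where "u = v - x"
    have xb: "x \<in> ball p r3" "dist p x < 1" "dist p x < g" using x by (auto simp: rb_def)
    have b: "(norm (v - p))\<^sup>2 < 2 * R * ((v - p) \<bullet> \<nu>)" using in_ball[OF v(1)] .
    have "ra\<^sup>2 \<le> (norm (v - p))\<^sup>2"
      using v(2) ra by (intro power_mono) (auto simp: dist_norm norm_minus_commute)
    then have vp: "4 * g \<le> (v - p) \<bullet> \<nu>" using b R by (simp add: g_def field_simps)
    have "(v - p) \<bullet> \<nu> \<le> norm (v - p)" using norm_cauchy_schwarz[of "v - p" \<nu>] by (simp add: norm_nu)
    then have "2 * R * ((v - p) \<bullet> \<nu>) \<le> 2 * R * norm (v - p)" using R by (intro mult_left_mono) auto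
    with b have "norm (v - p) * norm (v - p) < 2 * R * norm (v - p)" unfolding power2_eq_square by linarith
    then have "norm (v - p) < 2 * R"
      by (metis mult_less_cancel_right norm_ge_zero not_less_iff_gr_or_eq)
    then have uM: "norm u \<le> M"
      using norm_triangle_ineq[of "v - p" "p - x"] xb(2) by (simp add: M_def u_def dist_norm)
    have "(x - p) \<bullet> \<nu> \<le> norm (x - p)" using norm_cauchy_schwarz[of "x - p" \<nu>] by (simp add: norm_nu)
    then have "3 * g \<le> u \<bullet> \<nu>" using vp xb(3)
      by (simp add: u_def inner_diff_left dist_norm norm_minus_commute)
    moreover have "g / M * norm u \<le> g / M * M" using uM g M by (intro mult_left_mono) auto
    ultimately have "2 * g \<le> - D x u"
      using r3(2)[OF xb(1), of u] M unfolding D_p by (simp add: abs_le_iff)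
    moreover have "2 * g / M\<^sup>2 * (norm u)\<^sup>2 \<le> 2 * g / M\<^sup>2 * M\<^sup>2"
      using uM g by (intro mult_left_mono power_mono) auto
    ultimately show ?thesis using M by (simp add: Re_ell u_def)
  qed
  define c where "c = min (k / 4) (2 * g / M\<^sup>2)"
  have "c * (norm (v - x))\<^sup>2 \<le> Re (ell x (v - x))"
    if x: "x \<in> ball p rb" "\<rho> x = 0" and v: "v \<in> \<Omega>" for x v
  proof -
    have "c * (norm (v - x))\<^sup>2 \<le> k / 4 * (norm (v - x))\<^sup>2" "c * (norm (v - x))\<^sup>2 \<le> 2 * g / M\<^sup>2 * (norm (v - x))\<^sup>2"
      by (intro mult_right_mono; simp add: c_def)+
    then show ?thesis
      using near[of x v] far[of x v] x v by (cases "v \<in> ball p ra") (auto simp: rb_def)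
  qed
  moreover have "c > 0" using k g M by (simp add: c_def)
  ultimately show ?thesis using that rb by blast
qed

text \<open>The linear term makes \<rho> positive at some \<open>p - s *\<^sub>R \<nu>\<close>,
  hence near that point. Since \<rho> is negative at \<open>q\<close>, it vanishes on the segment
  from \<open>q\<close> in direction \<open>- \<nu>\<close>.\<close>

lemma boundary_below:
  assumes r: "r > 0"
  shows "\<exists>d>0. \<forall>q\<in>\<Omega> \<inter> ball p d.
        \<exists>t. 0 < t \<and> t < r \<and> q - t *\<^sub>R \<nu> \<in> ball p r \<and> \<rho> (q - t *\<^sub>R \<nu>) = 0"
proof -
  obtain r1 where r1: "r1 > 0" "ball p r1 \<subseteq> U" "\<And>x y. x \<in> ball p r1 \<Longrightarrow> y \<in> ball p r1 \<Longrightarrow>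
        \<bar>\<rho> y - \<rho> x - D x (y - x) - B (y - x) (y - x)\<bar> \<le> 1 * (norm (y - x))\<^sup>2"
    using taylor2[of 1] by auto
  define b where "b = \<bar>B \<nu> \<nu>\<bar> + 1"
  have b: "b > 0" by (simp add: b_def add_nonneg_pos)
  define r' where "r' = min r r1"
  \<comment> \<open>The second entry makes the linear gain \<open>s\<close> exceed the quadratic
    loss \<open>b * s\<^sup>2\<close>.\<close>
  define s where "s = min (r' / 2) (1 / (2 * b))"
  have s: "s > 0" "s < r'" "2 * s \<le> r'" "b * s < 1"
  proof -
    show "s > 0" "2 * s \<le> r'" using r r1 b by (auto simp: s_def r'_def)
    then show "s < r'" by simp
    have "s \<le> 1 / (2 * b)" by (simp add: s_def)
    then have "b * s \<le> 1 / 2" using b by (simp add: field_simps)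
    then show "b * s < 1" by simp
  qed
  have sb: "p - s *\<^sub>R \<nu> \<in> ball p r1" using s by (simp add: dist_norm norm_nu r'_def)
  have "\<bar>\<rho> (p - s *\<^sub>R \<nu>) - s - s\<^sup>2 * B \<nu> \<nu>\<bar> \<le> s\<^sup>2"
    using r1(3)[of p "p - s *\<^sub>R \<nu>"] r1(1) sb
    by (simp add: rho_p D_p nu_nu norm_nu B.minus_left B.minus_right B.scaleR_left B.scaleR_right power2_eq_square)
  then have "\<rho> (p - s *\<^sub>R \<nu>) \<ge> s + s\<^sup>2 * B \<nu> \<nu> - s\<^sup>2" by linarith
  moreover have "s\<^sup>2 * B \<nu> \<nu> \<ge> s\<^sup>2 * (- \<bar>B \<nu> \<nu>\<bar>)" by (intro mult_left_mono) auto
  moreover have "s * (b * s) < s * 1" using s by (intro mult_strict_left_mono) auto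
  ultimately have pos: "\<rho> (p - s *\<^sub>R \<nu>) > 0" by (simp add: b_def power2_eq_square algebra_simps)
  have cont: "continuous_on (ball p r1) \<rho>" using rho_cont r1(2) continuous_on_subset by blast
  then have "isCont \<rho> (p - s *\<^sub>R \<nu>)" using sb by (simp add: continuous_on_eq_continuous_at)
  then have "\<forall>\<^sub>F y in nhds (p - s *\<^sub>R \<nu>). \<rho> y > 0"
    using pos unfolding isCont_def tendsto_at_iff_tendsto_nhds by (rule order_tendstoD(1))
  then obtain d1 where d1: "d1 > 0" "\<And>y. dist y (p - s *\<^sub>R \<nu>) < d1 \<Longrightarrow> \<rho> y > 0"
    unfolding eventually_nhds_metric by blast
  define d where "d = min d1 (r' / 2)"
  have d: "d > 0" using d1 r r1 by (simp add: d_def r'_def)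
  have "\<exists>t. 0 < t \<and> t < r \<and> q - t *\<^sub>R \<nu> \<in> ball p r \<and> \<rho> (q - t *\<^sub>R \<nu>) = 0"
    if q: "q \<in> \<Omega>" "q \<in> ball p d" for q
  proof -
    have qd: "dist p q < d1" "dist p q < r' / 2" using q by (auto simp: d_def)
    have seg: "q - t *\<^sub>R \<nu> \<in> ball p r'" if "0 \<le> t" "t \<le> s" for t
    proof -
      have "dist p (q - t *\<^sub>R \<nu>) \<le> dist p q + norm (t *\<^sub>R \<nu>)"
        using norm_triangle_ineq[of "p - q" "t *\<^sub>R \<nu>"] by (simp add: dist_norm algebra_simps)
      then show ?thesis using qd that s by (simp add: norm_nu)
    qed
    have "q \<in> U" using seg[of 0] s r1(2) by (auto simp: r'_def)
    then have q0: "\<rho> q < 0" using q inside by blast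
    have "dist (q - s *\<^sub>R \<nu>) (p - s *\<^sub>R \<nu>) < d1" using qd by (simp add: dist_norm norm_minus_commute)
    then have qs: "\<rho> (q - s *\<^sub>R \<nu>) > 0" by (rule d1(2))
    have "continuous_on {0..s} (\<lambda>t. \<rho> (q - t *\<^sub>R \<nu>))"
      using seg by (intro continuous_on_compose2[OF cont] continuous_intros) (auto simp: r'_def)
    then obtain t where t: "0 \<le> t" "t \<le> s" "\<rho> (q - t *\<^sub>R \<nu>) = 0"
      using IVT'[of "\<lambda>t. \<rho> (q - t *\<^sub>R \<nu>)" 0 0 s] q0 qs s by auto
    have "t \<noteq> 0" using t q0 by auto
    then show ?thesis using t seg[OF t(1,2)] s by (auto intro!: exI[of _ t] simp: r'_def)
  qed
  with d show ?thesis by blast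
qed

lemma levi_normal_form_exists:
  obtains M c C where
    "levi_normal_form \<Omega> p \<nu> \<rho> ell P M lev (\<lambda>z. hb z z) c C"
proof -
  obtain K where K: "K > 0" "\<And>u v. \<bar>B u v\<bar> \<le> K * norm u * norm v" using B_bound by blast
  obtain c1 where c1: "c1 > 0" and
    supp: "\<exists>r>0. \<forall>x\<in>ball p r. \<rho> x = 0 \<longrightarrow> (\<forall>v\<in>\<Omega>. c1 * (norm (v - x))\<^sup>2 \<le> Re (ell x (v - x)))"
    using normal_supporting by blast
  obtain M :: "complex^'n \<Rightarrow> complex^'n" where M: "linear M" "\<And>k v. M (k *s v) = k *s M v" "bij M"
    "\<And>u. (norm (M u))\<^sup>2 = lev (P u) + (norm (ell p u))\<^sup>2"
    using levi_isometry by blast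
  define c where "c = min 1 (min c1 (1 / (2 * R)))"
  \<comment> \<open>The factor 2 arises because \<open>norm (hb z z)\<close> is estimated by its
    real and imaginary parts, each at most \<open>K * (norm z)\<^sup>2\<close>.\<close>
  define C where "C = max 1 (2 * K)"
  have c: "0 < c" "c \<le> 1" "c \<le> c1" "c \<le> 1 / (2 * R)" using c1 R by (auto simp: c_def)
  have tang: "c * (norm z)\<^sup>2 \<le> B z z" if "z \<bullet> \<nu> = 0" for z
    using B_tangent[OF that] mult_right_mono[OF c(4), of "(norm z)\<^sup>2"] by simp
  have bound: "\<bar>B u v\<bar> \<le> K * (norm z)\<^sup>2" if "norm u = norm z" "norm v = norm z" for u v z :: "complex^'n"
    using K(2)[of u v] that by (simp add: power2_eq_square)
  have CK: "2 * K * (norm z)\<^sup>2 \<le> C * (norm z)\<^sup>2" for z :: "complex^'n"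
    by (intro mult_right_mono) (auto simp: C_def)
  have K0: "0 \<le> K * (norm z)\<^sup>2" for z :: "complex^'n" using K by simp
  have bdd: "bounded \<Omega>"
  proof (rule boundedI)
    fix v assume v: "v \<in> \<Omega>"
    have "(v - p) \<bullet> \<nu> \<le> norm (v - p)" using norm_cauchy_schwarz[of "v - p" \<nu>] by (simp add: norm_nu)
    then have "2 * R * ((v - p) \<bullet> \<nu>) \<le> 2 * R * norm (v - p)" using R by (intro mult_left_mono) auto
    with in_ball[OF v] have "norm (v - p) * norm (v - p) < 2 * R * norm (v - p)" unfolding power2_eq_square by linarith
    then have "norm (v - p) < 2 * R"
      by (metis mult_less_cancel_right norm_ge_zero not_less_iff_gr_or_eq)
    then show "norm v \<le> 2 * R + norm p" using norm_triangle_ineq[of "v - p" p] by simp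
  qed
  have supp': "\<exists>r>0. \<forall>x\<in>ball p r. \<rho> x = 0 \<longrightarrow> (\<forall>v\<in>\<Omega>. c * (norm (v - x))\<^sup>2 \<le> Re (ell x (v - x)))"
  proof -
    have "c * (norm y)\<^sup>2 \<le> c1 * (norm y)\<^sup>2" for y :: "complex^'n" using c by (intro mult_right_mono) auto
    with supp show ?thesis by (meson order_trans)
  qed
  have "levi_normal_form \<Omega> p \<nu> \<rho> ell P M lev (\<lambda>z. hb z z) c C"
  proof (rule levi_normal_form.intro)
    fix z assume z: "ell p z = 0"
    note z' = ell_zeroD[OF z]
    show "c * (norm z)\<^sup>2 \<le> lev z"
      using tang[OF z'(1)] tang[OF z'(2)] by (simp add: lev_def norm_ii)
    show "c * (norm z)\<^sup>2 \<le> lev z + Re (hb z z)"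
      using tang[OF z'(1)] by (simp add: lev_plus_hb)
    note b = bound[of z z z] bound[of "\<i> *s z" z "\<i> *s z"] bound[of z z "\<i> *s z"] bound[of "\<i> *s z" z z]
    show "lev z \<le> C * (norm z)\<^sup>2"
      using b(1,2) CK[of z] K0[of z] by (simp add: lev_def norm_ii abs_le_iff)
    have "norm (hb z z) \<le> \<bar>Re (hb z z)\<bar> + \<bar>Im (hb z z)\<bar>" by (rule cmod_le)
    also have "\<dots> = \<bar>(B z z - B (\<i> *s z) (\<i> *s z)) / 2\<bar> + \<bar>B (\<i> *s z) z\<bar>"
      by (simp add: hb_def complexify_def ii_scale_scale B.minus_left B_sym[of z "\<i> *s z"] add_divide_distrib)
    also have "\<dots> \<le> K * (norm z)\<^sup>2 + K * (norm z)\<^sup>2"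
      using b by (intro add_mono) (auto simp: norm_ii abs_le_iff)
    finally show "norm (hb z z) \<le> C * (norm z)\<^sup>2" using CK[of z] by simp
  next
    show "1 \<le> C" by (simp add: C_def)
  qed (fact bdd supp' c M ell_clinear norm_nu ell_nu ell_le ell_cont P_def P_le lev_scale hb_holo
      normal_taylor boundary_below)+
  then show ?thesis using that by blast
qed

end

text \<open>Every direction in which \<rho> decreases at \<open>p\<close> enters the domain and so
  the enclosing ball. This forces the differential to be a negative multiple of the product with
  \<nu>, nonzero by regularity of the boundary; dividing by the factor \<open>k\<close> normalises
  it.\<close>

lemma spherically_extreme_boundary:
  fixes \<Omega> :: "(complex^'n) set"
  assumes "open \<Omega>" "spherically_extreme \<Omega> p"
  obtains U \<nu> R \<rho> D B where "extreme_boundary \<Omega> U p \<nu> R \<rho> D B"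
proof -
  have fr: "p \<in> frontier \<Omega>" using assms(2) by (simp add: spherically_extreme_def)
  obtain c R where cR: "\<Omega> \<subseteq> ball c R" "p \<in> sphere c R"
    using assms(2) by (auto simp: spherically_extreme_def)
  obtain U \<rho> D1 where U: "open U" "p \<in> U" and C2: "C2_defining_function U \<rho> D1"
    and \<Omega>U: "\<Omega> \<inter> U = {x\<in>U. \<rho> x < 0}" and nz: "\<forall>x\<in>U \<inter> frontier \<Omega>. D1 x \<noteq> 0"
    using assms(2) unfolding spherically_extreme_def C2_boundary_near_def by blast
  obtain D2 :: "complex^'n \<Rightarrow> (complex^'n) \<Rightarrow>\<^sub>L ((complex^'n) \<Rightarrow>\<^sub>L real)" where
      d1: "\<And>x. x \<in> U \<Longrightarrow> (\<rho> has_derivative blinfun_apply (D1 x)) (at x)"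
      and d2: "\<And>x. x \<in> U \<Longrightarrow> (D1 has_derivative blinfun_apply (D2 x)) (at x)"
    using C2 unfolding C2_defining_function_def by blast
  obtain H where H: "bounded_bilinear H" and
    taylor: "\<And>e. e > 0 \<Longrightarrow> \<exists>r>0. ball p r \<subseteq> U \<and> (\<forall>x\<in>ball p r. \<forall>y\<in>ball p r.
        \<bar>\<rho> y - \<rho> x - D1 x (y - x) - H (y - x) (y - x) / 2\<bar> \<le> e * (norm (y - x))\<^sup>2)"
    using C2_taylor[OF C2 U] by blast
  interpret H: bounded_bilinear H by fact
  have cont: "continuous_on U \<rho>"
    using d1 by (intro continuous_at_imp_continuous_on ballI has_derivative_continuous) auto
  have "p \<notin> \<Omega>" and pcl: "p \<in> closure \<Omega>" using fr assms(1) by (auto simp: frontier_def interior_open)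
  then have "\<Omega> \<noteq> {}" by auto
  then have R: "R > 0" using cR(1) by (metis ball_eq_empty not_le subset_empty)
  have rho_p: "\<rho> p = 0"
  proof (rule antisym)
    show "0 \<le> \<rho> p" using \<open>p \<notin> \<Omega>\<close> \<Omega>U U(2) by force
    \<comment> \<open>Otherwise a whole neighbourhood of \<open>p\<close> would miss the domain,
      although \<open>p\<close> lies in its closure.\<close>
    show "\<rho> p \<le> 0"
    proof (rule ccontr)
      assume "\<not> \<rho> p \<le> 0"
      moreover have "isCont \<rho> p" using cont U by (simp add: continuous_on_eq_continuous_at)
      ultimately have "\<forall>\<^sub>F y in nhds p. \<rho> y > 0"
        unfolding isCont_def tendsto_at_iff_tendsto_nhds by (intro order_tendstoD(1)) auto
      moreover have "\<forall>\<^sub>F y in nhds p. y \<in> U" using U by (rule eventually_nhds_in_open)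
      ultimately have "\<forall>\<^sub>F y in nhds p. y \<notin> \<Omega>"
        by eventually_elim (use \<Omega>U in force)
      then obtain S where S: "open S" "p \<in> S" "\<And>y. y \<in> S \<Longrightarrow> y \<notin> \<Omega>"
        unfolding eventually_nhds by blast
      then have "S \<inter> closure \<Omega> = {}" using open_Int_closure_eq_empty[OF S(1)] by blast
      then show False using S(2) pcl by blast
    qed
  qed
  define \<nu> where "\<nu> = (c - p) /\<^sub>R R"
  have norm_nu: "norm \<nu> = 1" using cR(2) R by (simp add: \<nu>_def dist_norm)
  have cp: "c - p = R *\<^sub>R \<nu>" using R by (simp add: \<nu>_def)
  have in_ball: "(norm (v - p))\<^sup>2 < 2 * R * ((v - p) \<bullet> \<nu>)" if "v \<in> \<Omega>" for v
  proof -
    have vc: "v - c = (v - p) - R *\<^sub>R \<nu>" using cp by (simp add: algebra_simps)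
    have "norm (v - c) < R" using that cR(1) by (auto simp: dist_norm norm_minus_commute)
    then have "(norm (v - c))\<^sup>2 < R\<^sup>2" by (intro power_strict_mono) auto
    also have "(norm (v - c))\<^sup>2 = (norm (v - p))\<^sup>2 - 2 * R * ((v - p) \<bullet> \<nu>) + R\<^sup>2"
      unfolding vc power2_norm_eq_inner using norm_nu
      by (simp add: inner_diff_left inner_diff_right inner_commute norm_eq_1 power2_eq_square)
    finally show ?thesis by simp
  qed
  have dir: "0 < u \<bullet> \<nu>" if u: "D1 p u < 0" for u
  proof -
    have "((\<lambda>t. \<rho> (p + t *\<^sub>R u)) has_real_derivative D1 p u) (at 0)"
    proof -
      have a: "((\<lambda>t. p + t *\<^sub>R u) has_derivative (\<lambda>s. s *\<^sub>R u)) (at 0)"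
        by (auto intro!: derivative_eq_intros)
      have "(\<rho> has_derivative D1 p) (at (p + 0 *\<^sub>R u))" using d1[OF U(2)] by simp
      from has_derivative_compose[OF a this] show ?thesis
        unfolding has_field_derivative_def
        by (rule has_derivative_eq_rhs) (auto simp: blinfun.scaleR_right)
    qed
    from DERIV_neg_dec_right[OF this u] obtain d where d: "d > 0" "\<And>t. t > 0 \<Longrightarrow> t < d \<Longrightarrow> \<rho> (p + t *\<^sub>R u) < 0"
      using rho_p by auto
    obtain r where r: "r > 0" "ball p r \<subseteq> U" using U open_contains_ball by blast
    have u0: "u \<noteq> 0" using u by auto
    define t where "t = min (d / 2) (r / (2 * norm u))"
    have t: "t > 0" "t < d" using d r u0 by (auto simp: t_def)
    have "t \<le> r / (2 * norm u)" by (simp add: t_def)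
    then have "t * norm u < r" using r(1) u0 by (simp add: field_simps)
    then have "p + t *\<^sub>R u \<in> U" using r t by (intro subsetD[OF r(2)]) (simp add: dist_norm)
    then have "p + t *\<^sub>R u \<in> \<Omega>" using d(2)[OF t] \<Omega>U by blast
    from in_ball[OF this] have "0 < 2 * R * ((p + t *\<^sub>R u - p) \<bullet> \<nu>)"
      using zero_le_power2[of "norm (p + t *\<^sub>R u - p)"] by linarith
    then show ?thesis using R t by (simp add: zero_less_mult_iff)
  qed
  define k where "k = - D1 p \<nu>"
  have nn: "\<nu> \<bullet> \<nu> = 1" using norm_nu by (simp add: norm_eq_1)
  \<comment> \<open>If the derivative were nonzero, \<open>w\<close> or \<open>- w\<close> would be
    a direction of decrease that does not point into the ball.\<close>
  have perp: "D1 p w = 0" if "w \<bullet> \<nu> = 0" for w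
    using dir[of w] dir[of "- w"] that by (cases "D1 p w" "0 :: real" rule: linorder_cases) (auto simp: blinfun.minus_right)
  have D1p: "D1 p u = - k * (u \<bullet> \<nu>)" for u
  proof -
    have "D1 p (u - (u \<bullet> \<nu>) *\<^sub>R \<nu>) = 0" by (rule perp) (simp add: inner_diff_left nn)
    then show ?thesis by (simp add: k_def blinfun.diff_right blinfun.scaleR_right)
  qed
  have k: "k > 0"
  proof (rule ccontr)
    assume "\<not> k > 0"
    moreover have "k \<noteq> 0"
    proof
      assume "k = 0"
      then have "D1 p = 0" by (intro blinfun_eqI) (simp add: D1p)
      then show False using nz U(2) fr by blast
    qed
    ultimately have "D1 p (- \<nu>) < 0" by (simp add: blinfun.minus_right k_def)
    from dir[OF this] show False by (simp add: nn)
  qed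
  \<comment> \<open>The factor 4 combines the 1/2 of the Taylor term with the 1/2 of symmetrisation;
    on the diagonal \<open>B u u = H u u / (2 * k)\<close>.\<close>
  define B where "B u v = (H u v + H v u) / (4 * k)" for u v
  have "extreme_boundary \<Omega> U p \<nu> R (\<lambda>x. \<rho> x / k) (\<lambda>x u. D1 x u / k) B"
  proof (rule extreme_boundary.intro)
    show "linear (\<lambda>u. D1 x u / k)" for x
      by (rule linearI) (simp_all add: blinfun.add_right blinfun.scaleR_right add_divide_distrib)
    show "D1 p u / k = - (u \<bullet> \<nu>)" for u using k by (simp add: D1p)
    show "\<exists>r>0. \<forall>x\<in>ball p r. \<forall>u. \<bar>D1 x u / k - D1 p u / k\<bar> \<le> e * norm u" if e: "e > 0" for e
    proof -
      have "isCont D1 p" using d2[OF U(2)] by (rule has_derivative_continuous)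
      then obtain r where r: "r > 0" "\<And>x. dist x p < r \<Longrightarrow> dist (D1 x) (D1 p) < e * k"
        using mult_pos_pos[OF e k] unfolding continuous_at_eps_delta by blast
      have "\<bar>D1 x u / k - D1 p u / k\<bar> \<le> e * norm u" if "x \<in> ball p r" for x u
      proof -
        have "\<bar>D1 x u - D1 p u\<bar> = norm ((D1 x - D1 p) u)" by (simp add: blinfun.diff_left)
        also have "\<dots> \<le> norm (D1 x - D1 p) * norm u" by (rule norm_blinfun)
        also have "\<dots> \<le> (e * k) * norm u"
          using r(2)[of x] that by (intro mult_right_mono) (auto simp: dist_norm norm_minus_commute)
        finally show ?thesis using k by (simp add: divide_simps mult_ac flip: diff_divide_distrib)
      qed
      with r show ?thesis by blast
    qed
    have "bilinear B"
      unfolding bilinear_def B_def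
      by (auto intro!: linearI simp: H.add_left H.add_right H.scaleR_left H.scaleR_right add_divide_distrib algebra_simps)
    then show "bounded_bilinear B" by (simp add: bilinear_conv_bounded_bilinear)
    show "B u v = B v u" for u v by (simp add: B_def add.commute)
    show "\<exists>r>0. ball p r \<subseteq> U \<and> (\<forall>x\<in>ball p r. \<forall>y\<in>ball p r.
        \<bar>\<rho> y / k - \<rho> x / k - D1 x (y - x) / k - B (y - x) (y - x)\<bar> \<le> e * (norm (y - x))\<^sup>2)" if e: "e > 0" for e
    proof -
      obtain r where r: "r > 0" "ball p r \<subseteq> U" "\<And>x y. x \<in> ball p r \<Longrightarrow> y \<in> ball p r \<Longrightarrow>
        \<bar>\<rho> y - \<rho> x - D1 x (y - x) - H (y - x) (y - x) / 2\<bar> \<le> e * k * (norm (y - x))\<^sup>2"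
        using taylor[of "e * k"] e k by auto
      have "\<bar>\<rho> y / k - \<rho> x / k - D1 x (y - x) / k - B (y - x) (y - x)\<bar> \<le> e * (norm (y - x))\<^sup>2"
        if "x \<in> ball p r" "y \<in> ball p r" for x y
      proof -
        have "\<rho> y / k - \<rho> x / k - D1 x (y - x) / k - B (y - x) (y - x)
            = (\<rho> y - \<rho> x - D1 x (y - x) - H (y - x) (y - x) / 2) / k"
          using k by (simp add: B_def diff_divide_distrib)
        also have "\<bar>\<dots>\<bar> \<le> e * k * (norm (y - x))\<^sup>2 / k"
          using divide_right_mono[OF r(3)[OF that], of k] k by (simp only: abs_divide abs_of_pos)
        finally show ?thesis using k by simp
      qed
      with r show ?thesis by blast
    qed
    show "v \<in> \<Omega> \<longleftrightarrow> \<rho> v / k < 0" if "v \<in> U" for v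
      using that \<Omega>U k by (auto simp: divide_less_0_iff)
    show "continuous_on U (\<lambda>x. \<rho> x / k)" using cont k by (intro continuous_intros) auto
  qed (use norm_nu R in_ball rho_p in auto)
  then show ?thesis using that by blast
qed

section \<open>From almost ball maps to the squeezing function\<close>

lemma ball_subset_scaled_image:
  fixes f :: "'a \<Rightarrow> complex^'n"
  assumes "s > 0" "ball 0 r \<subseteq> f ` S"
  shows "ball 0 (r / s) \<subseteq> (\<lambda>v. (1 / s) *\<^sub>R f v) ` S"
proof
  fix y :: "complex^'n" assume "y \<in> ball 0 (r / s)"
  then have "s *\<^sub>R y \<in> ball 0 r" using assms(1) by (simp add: field_simps)
  then obtain v where "v \<in> S" "f v = s *\<^sub>R y" using assms(2) by (metis imageE subsetD)
  then show "y \<in> (\<lambda>v. (1 / s) *\<^sub>R f v) ` S" using assms(1) by (intro image_eqI[of _ _ v]) auto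
qed

lemma squeezing_radius_le:
  fixes \<Omega> :: "(complex^'n) set"
  assumes "f \<in> squeezing_maps \<Omega> q" "ball 0 r \<subseteq> f ` \<Omega>"
  shows "r \<le> 1"
proof -
  have "ball (0 :: complex^'n) r \<subseteq> ball 0 1" using assms by (auto simp: squeezing_maps_def)
  then show ?thesis by (auto simp: ball_subset_ball_iff)
qed

text \<open>A supremum of reals is informative only for a nonempty set bounded above: the given map
  supplies a member, and \<open>squeezing_radius_le\<close> supplies the bound.\<close>

lemma squeezing_function_bounds:
  fixes \<Omega> :: "(complex^'n) set"
  assumes f: "f \<in> squeezing_maps \<Omega> q" "ball 0 r \<subseteq> f ` \<Omega>" and r: "r > 0"
  shows "r \<le> squeezing_function \<Omega> q" "squeezing_function \<Omega> q \<le> 1"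
proof -
  let ?S = "{r. r > 0 \<and> (\<exists>f\<in>squeezing_maps \<Omega> q. ball 0 r \<subseteq> f ` \<Omega>)}"
  have le: "x \<le> 1" if "x \<in> ?S" for x using that squeezing_radius_le by blast
  have mem: "r \<in> ?S" using assms by blast
  show "r \<le> squeezing_function \<Omega> q"
    unfolding squeezing_function_def using le by (intro cSup_upper mem bdd_aboveI[of _ 1]) auto
  show "squeezing_function \<Omega> q \<le> 1"
    unfolding squeezing_function_def using mem le by (intro cSup_least) auto
qed

theorem theorem3p1:
  fixes \<Omega> :: "(complex^'n) set" and p :: "complex^'n"
  assumes "open \<Omega>" and "connected \<Omega>"
    and "p \<in> frontier \<Omega>"
    and "spherically_extreme \<Omega> p"
  shows "(squeezing_function \<Omega> \<longlongrightarrow> 1) (at p within \<Omega>)"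
proof (rule tendstoI)
  fix \<epsilon> :: real assume "\<epsilon> > 0"
  \<comment> \<open>The first entry keeps \<open>1 - e\<close> positive; the second makes the final
    loss \<open>2 * e\<close> smaller than \<epsilon>.\<close>
  define e where "e = min (1 / 2) (\<epsilon> / 4)"
  have e: "0 < e" "e < 1" "2 * e < \<epsilon>" using \<open>\<epsilon> > 0\<close> by (auto simp: e_def)
  obtain U \<nu> R \<rho> D B where "extreme_boundary \<Omega> U p \<nu> R \<rho> D B"
    using spherically_extreme_boundary[OF assms(1,4)] .
  then interpret extreme_boundary \<Omega> U p \<nu> R \<rho> D B .
  obtain M c C where "levi_normal_form \<Omega> p \<nu> \<rho> ell P M lev (\<lambda>z. hb z z) c C"
    using levi_normal_form_exists .
  then interpret nf: levi_normal_form \<Omega> p \<nu> \<rho> ell P M lev "\<lambda>z. hb z z" c C .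
  obtain r where r: "r > 0" "\<And>q. q \<in> \<Omega> \<Longrightarrow> q \<in> ball p r \<Longrightarrow> \<exists>f :: complex^'n \<Rightarrow> complex^'n.
    holomorphic_map_on f \<Omega> \<and> inj_on f \<Omega> \<and> f q = 0 \<and>
      (\<forall>v\<in>\<Omega>. (norm (f v))\<^sup>2 \<le> 1 + e) \<and> ball 0 (1 - e) \<subseteq> f ` \<Omega>"
    using nf.almost_ball_near[OF e(1,2)] by blast
  have "dist (squeezing_function \<Omega> q) 1 < \<epsilon>" if q: "q \<in> \<Omega>" "dist q p < r" for q
  proof -
    obtain f :: "complex^'n \<Rightarrow> complex^'n" where f: "holomorphic_map_on f \<Omega>" "inj_on f \<Omega>" "f q = 0"
      and fle: "\<And>v. v \<in> \<Omega> \<Longrightarrow> (norm (f v))\<^sup>2 \<le> 1 + e" and onto: "ball 0 (1 - e) \<subseteq> f ` \<Omega>"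
      using r(2)[OF q(1)] q(2) by (auto simp: dist_commute)
    \<comment> \<open>Since \<open>(norm (f v))\<^sup>2 \<le> s < s\<^sup>2\<close>, dividing by
      \<open>s\<close> moves the image strictly into the unit ball. It still contains the ball of
      radius \<open>(1 - e) / s\<close>, which is at least \<open>1 - 2 * e\<close>.\<close>
    define s where "s = 1 + e"
    have s: "s > 0" using e by (simp add: s_def)
    let ?g = "\<lambda>v. (1 / s) *\<^sub>R f v"
    have "norm (?g v) < 1" if "v \<in> \<Omega>" for v
    proof -
      have "(norm (f v))\<^sup>2 \<le> s" using fle[OF that] by (simp add: s_def)
      also have "s < s\<^sup>2" using e by (simp add: s_def power2_eq_square algebra_simps add_pos_pos)
      finally have "(norm (f v))\<^sup>2 < s\<^sup>2" .
      then have "norm (f v) < s" using s by (simp add: power2_less_imp_less)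
      then show ?thesis using s by simp
    qed
    moreover have "holomorphic_map_on ?g \<Omega>"
      by (rule holomorphic_map_linear[OF f(1) bounded_linear_scaleR_right]) (simp add: vec_eq_iff)
    moreover have "inj_on ?g \<Omega>" using f(2) s by (auto simp: inj_on_def)
    ultimately have g: "?g \<in> squeezing_maps \<Omega> q" using f(3) by (auto simp: squeezing_maps_def)
    have "0 < (1 - e) / s" using e s by simp
    note b = squeezing_function_bounds[OF g ball_subset_scaled_image[OF s onto] this]
    have "1 - 2 * e \<le> (1 - e) / s"
    proof -
      have "(1 - 2 * e) * s \<le> 1 - e" using e by (simp add: s_def algebra_simps)
      then show ?thesis using s by (simp add: pos_le_divide_eq)
    qed
    then show ?thesis using b e by (simp add: dist_real_def)
  qed
  then show "\<forall>\<^sub>F q in at p within \<Omega>. dist (squeezing_function \<Omega> q) 1 < \<epsilon>"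
    unfolding eventually_at using r(1) by blast
qed

end
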